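(* Let $K \subset \mathcal{M}$ be a set that is compact in the weak-* topology and such that every $\mu \in K$ is strictly aperiodic. Let $\mu_1, \mu_2, \mu_3, \ldots$ be a sequence of measures in $K$. Let $\alpha_1, \alpha_2, \ldots$ be independent random elements of $\mathbb{A}$ such that $\alpha_j$ is distributed with respect to $\mu_j$, and let $\mathbb{P} = \prod_{n=1}^\infty \mu_n$ be the corresponding product probability measure on sequences $(\alpha_1,\alpha_2,\ldots)$. Then for any $\varphi \in C(\mathbb{A}, \mathbb{R})$ and any $x \in \mathbb{A}$, almost surely (with respect to $\mathbb{P}$) $$\frac{1}{n} \sum_{k=0}^{n-1} \varphi(x + \alpha_1 + \alpha_2 + \ldots + \alpha_k) \to \int_{\mathbb{A}} \varphi \, dh \quad \text{as } n \to \infty.$$ Moreover, for any $\varphi \in C(\mathbb{A}, \mathbb{R})$ and any $\varepsilon > 0$ there exist $C, \delta > 0$ such that for any $x \in \mathbb{A}$ and any $n \ge 1$ $$\mathbb{P}\left( \left| \frac{1}{n} \sum_{k=0}^{n-1} \varphi(x + \alpha_1 + \alpha_2 + \ldots + \alpha_k) - \int_{\mathbb{A}} \varphi \, dh \right| > \varepsilon \right) < C \exp(-\delta n).$$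
   Context: $(\mathbb{A}, 0, +)$ is a compact metrizable abelian topological group, equipped with a shift-invariant metric $d$ inducing its topology: $d(x+\alpha, y+\alpha) = d(x,y)$ for all $\alpha, x, y \in \mathbb{A}$. $\mathcal{B}$ is the Borel $\sigma$-algebra of $\mathbb{A}$, $h$ is the Haar measure (the unique shift-invariant Borel probability measure on $\mathbb{A}$), and $\mathcal{M}$ is the space of all probability measures on $(\mathbb{A}, \mathcal{B})$. For $\mu \in \mathcal{M}$, $\mathrm{supp}(\mu)$ denotes the topological support, i.e. the smallest closed subset of full measure. A measure $\mu \in \mathcal{M}$ is called strictly aperiodic if the smallest semigroup containing $\{\alpha - \beta \mid \alpha, \beta \in \mathrm{supp}(\mu)\}$ is dense in $\mathbb{A}$. For $k = 0$ the expression $x + \alpha_1 + \ldots + \alpha_k$ means $x$. *)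

theory Defs
  imports "HOL-Probability.Probability"
begin

class compact_metric_ab_group = metric_space + topological_ab_group_add +
  assumes compact_UNIV_group: "compact (UNIV :: 'a set)"
    and dist_add_right: "dist (x + a) (y + a) = dist x y"

instance compact_metric_ab_group \<subseteq> second_countable_topology
proof
  have "\<exists>C. finite C \<and> (UNIV :: 'a set) \<subseteq> (\<Union>c\<in>C. ball c (1 / real (Suc n)))" for n
  proof -
    have "(UNIV :: 'a set) \<subseteq> (\<Union>c\<in>UNIV. ball c (1 / real (Suc n)))"
      by auto
    then show ?thesis
      by (rule compactE_image[OF compact_UNIV_group, rotated]) auto
  qed
  then obtain C where C: "\<And>n. finite (C n)"
      "\<And>n. (UNIV :: 'a set) \<subseteq> (\<Union>c\<in>C n. ball c (1 / real (Suc n)))"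
    by metis
  define B where "B = (\<Union>n. (\<lambda>c. ball c (1 / real (Suc n))) ` C n)"
  have "countable B"
    unfolding B_def using C(1) by (intro countable_UN countable_image) (auto intro: countable_finite)
  moreover have "topological_basis B"
  proof (rule topological_basisI)
    show "open U" if "U \<in> B" for U using that by (auto simp: B_def)
    fix S :: "'a set" and x assume "open S" "x \<in> S"
    then obtain e where e: "e > 0" "ball x e \<subseteq> S" by (meson openE)
    obtain n where n: "1 / real (Suc n) < e / 2"
      using nat_approx_posE[of "e/2"] e(1) by auto
    obtain c where c: "c \<in> C n" "dist c x < 1 / real (Suc n)"
      using subsetD[OF C(2) UNIV_I, of x n] by (auto simp del: of_nat_Suc)
    have "ball c (1 / real (Suc n)) \<subseteq> ball x e"
    proof
      fix y assume "y \<in> ball c (1 / real (Suc n))"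
      then show "y \<in> ball x e"
        using c(2) n dist_triangle[of x y c] by (simp add: dist_commute)
    qed
    with e c show "\<exists>U\<in>B. x \<in> U \<and> U \<subseteq> S"
      unfolding B_def by (intro bexI[of _ "ball c (1 / real (Suc n))"]) auto
  qed
  ultimately show "\<exists>B :: 'a set set. countable B \<and> open = generate_topology B"
    using topological_basis_imp_subbasis by blast
qed

definition borel_prob_measures :: "'a::topological_space measure set" where
  "borel_prob_measures = {\<mu>. sets \<mu> = sets borel \<and> prob_space \<mu>}"

definition is_haar :: "'a::compact_metric_ab_group measure \<Rightarrow> bool" where
  "is_haar h \<longleftrightarrow> h \<in> borel_prob_measures \<and> (\<forall>a. distr h borel (\<lambda>x. x + a) = h)"

text \<open>
  The coarsest topology on the Borel probability measures for which integration against every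
  continuous function is continuous.
\<close>
definition weak_star :: "'a::compact_metric_ab_group measure topology" where
  "weak_star = topology_generated_by
     {{\<mu> \<in> borel_prob_measures. (\<integral>y. \<phi> y \<partial>\<mu>) \<in> U} |(\<phi> :: 'a \<Rightarrow> real) U.
        continuous_on UNIV \<phi> \<and> open U}"

lemma topspace_weak_star [simp]: "topspace weak_star = borel_prob_measures"
proof -
  have "borel_prob_measures \<in> {{\<mu> \<in> borel_prob_measures. (\<integral>y. \<phi> y \<partial>\<mu>) \<in> U} |(\<phi> :: 'a \<Rightarrow> real) U.
        continuous_on UNIV \<phi> \<and> open U}"
    by (rule CollectI, rule exI[of _ "\<lambda>_. 0"], rule exI[of _ UNIV]) auto
  then show ?thesis
    unfolding weak_star_def topology_generated_by_topspace by blast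
qed

definition topological_support :: "'a::topological_space measure \<Rightarrow> 'a set" where
  "topological_support \<mu> = \<Inter>{F. closed F \<and> measure \<mu> F = 1}"

text \<open>The intersection has itself full measure, so it is the smallest closed set that does.\<close>
lemma topological_support_full:
  fixes \<mu> :: "'a::second_countable_topology measure"
  assumes "\<mu> \<in> borel_prob_measures"
  shows "closed (topological_support \<mu>)" "measure \<mu> (topological_support \<mu>) = 1"
proof -
  interpret prob_space \<mu> using assms by (simp add: borel_prob_measures_def)
  have [measurable_cong]: "sets \<mu> = sets borel" using assms by (simp add: borel_prob_measures_def)
  have sp: "space \<mu> = UNIV"
    using \<open>sets \<mu> = sets borel\<close> sets_eq_imp_space_eq space_borel by blast
  show cl: "closed (topological_support \<mu>)" by (auto simp: topological_support_def)
  define \<F> where "\<F> = {- F |F. closed F \<and> measure \<mu> F = 1}"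
  have eq: "topological_support \<mu> = - \<Union>\<F>"
    by (auto simp: topological_support_def \<F>_def)
  have open_\<F>: "open S" if "S \<in> \<F>" for S
    using that by (auto simp: \<F>_def)
  obtain \<G> where \<G>: "\<G> \<subseteq> \<F>" "countable \<G>" "\<Union>\<G> = \<Union>\<F>"
    by (rule Lindelof[OF open_\<F>])
  have "G \<in> null_sets \<mu>" if G: "G \<in> \<G>" for G
  proof -
    obtain F where F: "G = - F" "closed F" "measure \<mu> F = 1"
      using subsetD[OF \<G>(1) G] unfolding \<F>_def by blast
    then have ev: "F \<in> events" "G \<in> events"
      by (simp_all add: \<open>sets \<mu> = sets borel\<close> borel_closed borel_open open_Compl)
    have "prob G = 0"
      using prob_compl[OF \<open>F \<in> events\<close>] F by (simp add: sp Compl_eq_Diff_UNIV)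
    then show ?thesis using ev by (simp add: null_sets_def emeasure_eq_measure)
  qed
  then have "\<Union>\<G> \<in> null_sets \<mu>"
    using null_sets_UN'[OF \<G>(2), of id] by auto
  then have "prob (\<Union>\<F>) = 0" "\<Union>\<F> \<in> events"
    using \<G>(3) by (auto simp: null_sets_def emeasure_eq_measure)
  then show "prob (topological_support \<mu>) = 1"
    using prob_compl[of "\<Union>\<F>"] by (simp add: eq sp Compl_eq_Diff_UNIV)
qed

definition add_closed :: "'a::plus set \<Rightarrow> bool" where
  "add_closed G \<longleftrightarrow> (\<forall>a\<in>G. \<forall>b\<in>G. a + b \<in> G)"

definition strictly_aperiodic :: "'a::compact_metric_ab_group measure \<Rightarrow> bool" where
  "strictly_aperiodic \<mu> \<longleftrightarrow>
     closure (add_closed hull {a - b |a b. a \<in> topological_support \<mu> \<and> b \<in> topological_support \<mu>}) = UNIV"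

end

theory Submission
  imports Defs
begin

text \<open>
  Write \<open>P\<^sub>\<nu> f x\<close> for the expectation of \<open>f (x + \<alpha>)\<close>, where \<open>\<alpha>\<close> has law \<open>\<nu>\<close>. The proof has two parts: the
  compositions of operators \<open>P\<^sub>\<nu>\<close> with \<open>\<nu>\<close> in \<open>K\<close> converge to the Haar mean uniformly in the choice of
  the measures, and this uniform convergence alone yields exponential moment bounds.

  For the first part, consider the energy of \<open>f\<close>, the integral of \<open>f\<^sup>2\<close> with respect to \<open>h\<close>. Invariance of
  \<open>h\<close> shows that \<open>P\<^sub>\<nu>\<close> decreases it by the integral over \<open>x\<close> of the variance of \<open>f (x + \<alpha>)\<close>
  (\<open>energy_loss_eq_variance\<close>). The loss could vanish only if \<open>f\<close> were invariant under all differences of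
  points in the support of \<open>\<nu>\<close>, hence under a dense semigroup, hence constant. The quantitative form is
  \<open>locally_uniform_loss_oscillation\<close>: a function with a given modulus of continuity and oscillation at
  least \<open>\<kappa>\<close> loses a fixed amount of energy, the same for all measures in a weak-* neighbourhood of \<open>\<nu>\<close>.
  Compactness of \<open>K\<close> makes the amount uniform (\<open>uniform_loss_compact\<close>). The operators \<open>P\<^sub>\<nu>\<close> preserve moduli
  of continuity, as the metric is invariant, and the energy of \<open>\<phi>\<close> is finite; so after a bounded
  number of steps the oscillation is below \<open>\<kappa>\<close> (\<open>foldr_convolve_tendsto_uniformly\<close>).

  For the second part, let \<open>\<phi>\<close> have mean zero. The expected ergodic sum over a long block of \<open>m\<close> steps
  is at most a small multiple of \<open>m\<close>, whatever the measures and the starting point. Expanding to second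
  order in a small \<open>s\<close>, the expectation of the exponential of \<open>s\<close> times the block sum is bounded
  accordingly, and by the Markov property the bounds for consecutive blocks multiply
  (\<open>exp_moment_growth\<close>). Markov's inequality turns this into an exponential tail bound, and
  Borel--Cantelli into almost sure convergence.
\<close>

section \<open>Averaging operators\<close>

text \<open>
  For a random element \<open>\<alpha>\<close> with law \<open>\<nu>\<close>, this is the expectation of \<open>f (x + \<alpha>)\<close>: the Markov operator of one
  step of the walk. Hence \<open>foldr convolve [\<nu>1, \<dots>, \<nu>k] f x\<close> is the expectation of
  \<open>f (x + \<alpha>1 + \<dots> + \<alpha>k)\<close>, the first step being the outermost operator.
\<close>
definition convolve :: "'a::compact_metric_ab_group measure \<Rightarrow> ('a \<Rightarrow> real) \<Rightarrow> 'a \<Rightarrow> real" where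
  "convolve \<nu> f x = (\<integral>a. f (x + a) \<partial>\<nu>)"

lemma dist_add_left:
  fixes x y a :: "'a::compact_metric_ab_group"
  shows "dist (a + x) (a + y) = dist x y"
  using dist_add_right[of x a y] by (simp add: add.commute)

lemma borel_prob_measuresD:
  assumes "\<nu> \<in> borel_prob_measures"
  shows "prob_space \<nu>" "sets \<nu> = sets borel" "space \<nu> = UNIV"
proof -
  show s: "sets \<nu> = sets borel" and "prob_space \<nu>"
    using assms by (auto simp: borel_prob_measures_def)
  show "space \<nu> = UNIV"
    using sets_eq_imp_space_eq[OF s] by simp
qed

lemma continuous_on_translate:
  fixes f :: "'a::compact_metric_ab_group \<Rightarrow> real"
  assumes "continuous_on UNIV f"
  shows "continuous_on UNIV (\<lambda>a. f (x + a))"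
  by (rule continuous_on_compose2[OF assms]) (auto intro!: continuous_intros)

lemma continuous_bounded:
  fixes f :: "'a::compact_metric_ab_group \<Rightarrow> real"
  assumes "continuous_on UNIV f"
  obtains B where "B > 0" "\<And>x. \<bar>f x\<bar> \<le> B"
proof -
  have "bounded (range f)"
    by (intro compact_imp_bounded compact_continuous_image assms compact_UNIV_group)
  then obtain B where "B > 0" "\<And>x. \<bar>f x\<bar> \<le> B"
    unfolding bounded_pos by auto
  then show thesis using that by blast
qed

lemma measurable_continuous:
  fixes f :: "'a::compact_metric_ab_group \<Rightarrow> real"
  assumes "\<nu> \<in> borel_prob_measures" "continuous_on UNIV f"
  shows "f \<in> borel_measurable \<nu>"
  by (subst measurable_cong_sets[OF borel_prob_measuresD(2)[OF assms(1)] refl])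
    (rule borel_measurable_continuous_onI[OF assms(2)])

lemma integrable_continuous:
  fixes f :: "'a::compact_metric_ab_group \<Rightarrow> real"
  assumes "\<nu> \<in> borel_prob_measures" "continuous_on UNIV f"
  shows "integrable \<nu> f"
proof -
  interpret prob_space \<nu> using assms by (simp add: borel_prob_measures_def)
  obtain B where "\<And>x. \<bar>f x\<bar> \<le> B" using continuous_bounded[OF assms(2)] by blast
  then show ?thesis
    using measurable_continuous[OF assms]
    by (intro integrable_const_bound[where B=B]) auto
qed

lemmas integrable_translate = integrable_continuous[OF _ continuous_on_translate]

lemma convolve_mono:
  assumes "\<nu> \<in> borel_prob_measures" "continuous_on UNIV f" "continuous_on UNIV g"
    and "\<And>x. f x \<le> g x"
  shows "convolve \<nu> f x \<le> convolve \<nu> g x"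
  unfolding convolve_def by (intro integral_mono integrable_translate assms)

lemma convolve_const [simp]:
  assumes "\<nu> \<in> borel_prob_measures"
  shows "convolve \<nu> (\<lambda>x. c) x = c"
proof -
  interpret prob_space \<nu> using assms by (simp add: borel_prob_measures_def)
  show ?thesis by (simp add: convolve_def prob_space)
qed

lemma convolve_diff_le:
  assumes "\<nu> \<in> borel_prob_measures" "continuous_on UNIV f"
    and "\<And>a. \<bar>f (x + a) - f (y + a)\<bar> \<le> e"
  shows "\<bar>convolve \<nu> f x - convolve \<nu> f y\<bar> \<le> e"
proof -
  interpret prob_space \<nu> using assms by (simp add: borel_prob_measures_def)
  note I = integrable_translate[OF assms(1,2)]
  have "convolve \<nu> f x - convolve \<nu> f y = (\<integral>a. f (x + a) - f (y + a) \<partial>\<nu>)"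
    unfolding convolve_def using I by simp
  also have "\<bar>\<dots>\<bar> \<le> (\<integral>a. \<bar>f (x + a) - f (y + a)\<bar> \<partial>\<nu>)"
    by (rule integral_abs_bound)
  also have "\<dots> \<le> (\<integral>a. e \<partial>\<nu>)"
    using assms(3) I by (intro integral_mono) auto
  finally show ?thesis by (simp add: prob_space)
qed

text \<open>
  A modulus of continuity \<open>\<delta>\<close> of \<open>\<phi>\<close> passes to every function obtained from \<open>\<phi>\<close> by averaging over
  translations, because the metric is invariant. Estimates that see a function only through its
  modulus are therefore uniform over all compositions of averaging operators applied to \<open>\<phi>\<close>.
\<close>
definition has_modulus :: "(real \<Rightarrow> real) \<Rightarrow> ('a::metric_space \<Rightarrow> real) \<Rightarrow> bool" where
  "has_modulus \<delta> f \<longleftrightarrow> (\<forall>e>0. \<delta> e > 0 \<and> (\<forall>x y. dist x y < \<delta> e \<longrightarrow> \<bar>f x - f y\<bar> \<le> e))"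

lemma has_modulusD:
  assumes "has_modulus \<delta> f" "e > 0"
  shows "\<delta> e > 0" "dist x y < \<delta> e \<Longrightarrow> \<bar>f x - f y\<bar> \<le> e"
  using assms by (auto simp: has_modulus_def)

lemma has_modulus_continuous:
  assumes "has_modulus \<delta> f"
  shows "continuous_on UNIV f"
  unfolding continuous_on_iff
proof (intro ballI allI impI)
  fix x and e :: real assume "e > 0"
  then have "e / 2 > 0" by simp
  note * = has_modulusD[OF assms this]
  have "dist (f y) (f x) < e" if "dist y x < \<delta> (e / 2)" for y
    using *(2)[OF that] \<open>e > 0\<close> by (simp add: dist_real_def)
  with *(1) show "\<exists>d>0. \<forall>y\<in>UNIV. dist y x < d \<longrightarrow> dist (f y) (f x) < e"
    by blast
qed

lemma continuous_has_modulus: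
  fixes f :: "'a::compact_metric_ab_group \<Rightarrow> real"
  assumes "continuous_on UNIV f"
  obtains \<delta> where "has_modulus \<delta> f"
proof -
  have "uniformly_continuous_on UNIV f"
    by (rule compact_uniformly_continuous[OF assms compact_UNIV_group])
  then have "\<forall>e. \<exists>d. e > 0 \<longrightarrow> d > 0 \<and> (\<forall>x y. dist x y < d \<longrightarrow> \<bar>f x - f y\<bar> \<le> e)"
    unfolding uniformly_continuous_on_def dist_real_def
    by (metis UNIV_I dist_commute less_imp_le)
  then show thesis
    using that unfolding has_modulus_def by metis
qed

lemma has_modulus_convolve:
  assumes "\<nu> \<in> borel_prob_measures" "has_modulus \<delta> f"
  shows "has_modulus \<delta> (convolve \<nu> f)"
  unfolding has_modulus_def
proof (intro allI impI conjI)
  fix e :: real assume e: "e > 0"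
  show "\<delta> e > 0" by (rule has_modulusD[OF assms(2) e])
  fix x y :: 'a assume d: "dist x y < \<delta> e"
  have "\<bar>f (x + a) - f (y + a)\<bar> \<le> e" for a
    using has_modulusD(2)[OF assms(2) e, of "x + a" "y + a"] d by (simp add: dist_add_right)
  then show "\<bar>convolve \<nu> f x - convolve \<nu> f y\<bar> \<le> e"
    by (rule convolve_diff_le[OF assms(1) has_modulus_continuous[OF assms(2)]])
qed

lemma continuous_convolve:
  assumes "\<nu> \<in> borel_prob_measures" "continuous_on UNIV f"
  shows "continuous_on UNIV (convolve \<nu> f)"
proof -
  obtain \<delta> where "has_modulus \<delta> f" using continuous_has_modulus[OF assms(2)] .
  then show ?thesis
    by (intro has_modulus_continuous has_modulus_convolve assms)
qed

section \<open>Haar measure and loss of energy\<close>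

lemma is_haarD:
  assumes "is_haar h"
  shows "h \<in> borel_prob_measures" "distr h borel (\<lambda>x. x + a) = h"
  using assms by (auto simp: is_haar_def)

lemma integral_haar_translate:
  fixes f :: "'a::compact_metric_ab_group \<Rightarrow> real"
  assumes "is_haar h" "continuous_on UNIV f"
  shows "(\<integral>x. f (x + a) \<partial>h) = (\<integral>x. f x \<partial>h)"
proof -
  have [measurable]: "f \<in> borel_measurable borel"
    by (rule borel_measurable_continuous_onI[OF assms(2)])
  have [measurable_cong]: "sets h = sets borel"
    by (rule borel_prob_measuresD(2)[OF is_haarD(1)[OF assms(1)]])
  have "(\<integral>x. f x \<partial>h) = (\<integral>x. f x \<partial>distr h borel (\<lambda>x. x + a))"
    by (simp add: is_haarD(2)[OF assms(1)])
  also have "\<dots> = (\<integral>x. f (x + a) \<partial>h)"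
    by (subst integral_distr) auto
  finally show ?thesis by simp
qed

lemma integral_convolve_haar:
  assumes h: "is_haar h" and \<nu>: "\<nu> \<in> borel_prob_measures" and f: "continuous_on UNIV f"
  shows "(\<integral>x. convolve \<nu> f x \<partial>h) = (\<integral>x. f x \<partial>h)"
proof -
  interpret h: prob_space h by (rule borel_prob_measuresD(1)[OF is_haarD(1)[OF h]])
  interpret \<nu>: prob_space \<nu> by (rule borel_prob_measuresD(1)[OF \<nu>])
  interpret pair_prob_space h \<nu> ..
  have [measurable]: "f \<in> borel_measurable borel"
    by (rule borel_measurable_continuous_onI[OF f])
  have [measurable_cong]: "sets h = sets borel" "sets \<nu> = sets borel"
    using borel_prob_measuresD(2)[OF is_haarD(1)[OF h]] borel_prob_measuresD(2)[OF \<nu>] by auto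
  obtain B where B: "\<And>x. \<bar>f x\<bar> \<le> B" using continuous_bounded[OF f] by blast
  have "integrable (h \<Otimes>\<^sub>M \<nu>) (\<lambda>(x, a). f (x + a))"
    using B by (intro integrable_const_bound[where B=B]) auto
  then have "(\<integral>x. convolve \<nu> f x \<partial>h) = (\<integral>a. (\<integral>x. f (x + a) \<partial>h) \<partial>\<nu>)"
    unfolding convolve_def by (simp add: Fubini_integral)
  also have "\<dots> = (\<integral>x. f x \<partial>h)"
    using \<nu>.prob_space by (simp add: integral_haar_translate[OF h f])
  finally show ?thesis .
qed

text \<open>
  All balls of radius \<open>r\<close> are translates of each other, so they have the same measure, and finitely
  many of them cover the group.
\<close>
lemma haar_ball_pos:
  fixes h :: "'a::compact_metric_ab_group measure"
  assumes h: "is_haar h" and r: "r > 0"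
  obtains c where "c > 0" "\<forall>y. measure h (ball y r) = c"
proof -
  interpret h: prob_space h by (rule borel_prob_measuresD(1)[OF is_haarD(1)[OF h]])
  have [measurable_cong, simp]: "sets h = sets borel"
    by (rule borel_prob_measuresD(2)[OF is_haarD(1)[OF h]])
  have sp[simp]: "space h = UNIV" by (rule borel_prob_measuresD(3)[OF is_haarD(1)[OF h]])
  have eq: "measure h (ball y r) = measure h (ball 0 r)" for y
  proof -
    have "measure h (ball y r) = measure (distr h borel (\<lambda>x. x + y)) (ball y r)"
      by (simp add: is_haarD(2)[OF h])
    also have "\<dots> = measure h ((\<lambda>x. x + y) -` ball y r \<inter> space h)"
      by (subst measure_distr) auto
    also have "(\<lambda>x. x + y) -` ball y r \<inter> space h = ball 0 r"
      using dist_add_right[of 0 y] by auto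
    finally show ?thesis .
  qed
  have "(UNIV :: 'a set) \<subseteq> (\<Union>y\<in>UNIV. ball y r)" using r by auto
  then obtain C where C: "finite C" "(UNIV :: 'a set) \<subseteq> (\<Union>y\<in>C. ball y r)"
    by (rule compactE_image[OF compact_UNIV_group, rotated]) auto
  have "1 = measure h (\<Union>y\<in>C. ball y r)"
    using h.prob_space C(2) by (simp add: top.extremum_unique)
  also have "\<dots> \<le> (\<Sum>y\<in>C. measure h (ball y r))"
    using C(1) by (intro h.finite_measure_subadditive_finite) auto
  also have "\<dots> = (\<Sum>y\<in>C. measure h (ball 0 r))"
    by (intro sum.cong refl eq)
  finally have "measure h (ball 0 r) \<noteq> 0" by auto
  then have "measure h (ball 0 r) > 0" by (simp add: less_le)
  moreover have "\<forall>y. measure h (ball y r) = measure h (ball 0 r)"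
    using eq by (intro allI)
  ultimately show thesis by (rule that)
qed

text \<open>
  The energy of \<open>f\<close> is its squared norm in \<open>L\<^sup>2(h)\<close>. Averaging cannot increase it, and the decrease
  measures how far \<open>f\<close> is from being invariant under the differences of points in the support of
  \<open>\<nu>\<close>.
\<close>
definition energy_loss ::
  "'a::compact_metric_ab_group measure \<Rightarrow> 'a measure \<Rightarrow> ('a \<Rightarrow> real) \<Rightarrow> real" where
  "energy_loss h \<nu> f = (\<integral>x. (f x)\<^sup>2 \<partial>h) - (\<integral>x. (convolve \<nu> f x)\<^sup>2 \<partial>h)"

text \<open>
  By invariance of \<open>h\<close> the energy of \<open>f\<close> is the integral of the second moment of \<open>f (x + \<alpha>)\<close> over
  \<open>x\<close>; subtracting the square of the first moment leaves the variance.
\<close>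
lemma energy_loss_eq_variance:
  assumes h: "is_haar h" and \<nu>: "\<nu> \<in> borel_prob_measures" and f: "continuous_on UNIV f"
  shows "energy_loss h \<nu> f = (\<integral>x. (\<integral>a. (f (x + a) - convolve \<nu> f x)\<^sup>2 \<partial>\<nu>) \<partial>h)"
    and "integrable h (\<lambda>x. (\<integral>a. (f (x + a) - convolve \<nu> f x)\<^sup>2 \<partial>\<nu>))"
proof -
  interpret \<nu>: prob_space \<nu> by (rule borel_prob_measuresD(1)[OF \<nu>])
  have f2: "continuous_on UNIV (\<lambda>x. (f x)\<^sup>2)"
    by (intro continuous_intros f)
  have var: "(\<integral>a. (f (x + a) - convolve \<nu> f x)\<^sup>2 \<partial>\<nu>)
      = convolve \<nu> (\<lambda>x. (f x)\<^sup>2) x - (convolve \<nu> f x)\<^sup>2" for x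
    using \<nu>.variance_eq[OF integrable_translate[OF \<nu> f] integrable_translate[OF \<nu> f2]]
    by (simp add: convolve_def)
  have i1: "integrable h (convolve \<nu> (\<lambda>x. (f x)\<^sup>2))"
    by (intro integrable_continuous is_haarD(1)[OF h] continuous_convolve \<nu> f2)
  have i2: "integrable h (\<lambda>x. (convolve \<nu> f x)\<^sup>2)"
    by (intro integrable_continuous is_haarD(1)[OF h] continuous_intros continuous_convolve \<nu> f)
  show "integrable h (\<lambda>x. (\<integral>a. (f (x + a) - convolve \<nu> f x)\<^sup>2 \<partial>\<nu>))"
    unfolding var using i1 i2 by simp
  show "energy_loss h \<nu> f = (\<integral>x. (\<integral>a. (f (x + a) - convolve \<nu> f x)\<^sup>2 \<partial>\<nu>) \<partial>h)"
    unfolding var energy_loss_def using i1 i2 integral_convolve_haar[OF h \<nu> f2] by simp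
qed

lemma integral_ge_measure:
  fixes g :: "'a \<Rightarrow> real"
  assumes "prob_space M" "integrable M g" "\<And>x. g x \<ge> 0" "A \<in> sets M" "\<And>x. x \<in> A \<Longrightarrow> g x \<ge> c"
  shows "c * measure M A \<le> (\<integral>x. g x \<partial>M)"
proof -
  interpret prob_space M by fact
  have "(\<integral>x. c * indicator A x \<partial>M) \<le> (\<integral>x. g x \<partial>M)"
    using assms by (intro integral_mono integrable_mult_right integrable_real_indicator)
      (auto split: split_indicator simp: emeasure_eq_measure)
  then show ?thesis using assms(4) by simp
qed

text \<open>
  If \<open>f\<close> takes values at distance at least \<open>\<kappa>\<close> at \<open>y + a\<close> and \<open>y + b\<close>, then it still does so, up to
  \<open>\<kappa> / 4\<close>, at \<open>x + a'\<close> and \<open>x + b'\<close> for \<open>x\<close>, \<open>a'\<close>, \<open>b'\<close> near \<open>y\<close>, \<open>a\<close>, \<open>b\<close>. The mean of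
  \<open>f (x + \<alpha>)\<close> cannot be close to both values, so one of the two balls contributes to the variance
  for every \<open>x\<close> in a ball of positive Haar measure. The bound depends on \<open>f\<close> only through its
  modulus, and on \<open>\<nu>\<close> only through the mass of two balls.
\<close>
lemma energy_loss_ge:
  assumes h: "is_haar h" and \<nu>: "\<nu> \<in> borel_prob_measures" and f: "has_modulus \<delta> f"
    and \<kappa>: "\<kappa> > 0" and r: "2 * r = \<delta> (\<kappa> / 8)"
    and z: "\<bar>f (y + a) - f (y + b)\<bar> \<ge> \<kappa>"
    and c: "c \<le> measure \<nu> (ball a r)" "c \<le> measure \<nu> (ball b r)"
  shows "\<kappa>\<^sup>2 / 16 * c * measure h (ball y r) \<le> energy_loss h \<nu> f"
proof -
  note fc = has_modulus_continuous[OF f]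
  have [measurable_cong, simp]: "sets h = sets borel" "sets \<nu> = sets borel"
    using borel_prob_measuresD(2)[OF is_haarD(1)[OF h]] borel_prob_measuresD(2)[OF \<nu>] by auto
  define V where "V x = (\<integral>a. (f (x + a) - convolve \<nu> f x)\<^sup>2 \<partial>\<nu>)" for x
  have V0: "V x \<ge> 0" for x unfolding V_def by (intro integral_nonneg_AE) auto
  have near: "\<bar>f (x + a') - f (y + a'')\<bar> \<le> \<kappa> / 8" if "x \<in> ball y r" "a' \<in> ball a'' r" for x a' a''
  proof -
    have "dist (x + a') (y + a'') \<le> dist (x + a') (y + a') + dist (y + a') (y + a'')"
      by (rule dist_triangle)
    also have "\<dots> < 2 * r"
      using that by (simp add: dist_add_right dist_add_left dist_commute)
    finally show ?thesis using has_modulusD(2)[OF f, of "\<kappa> / 8"] \<kappa> r by simp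
  qed
  have Vge: "\<kappa>\<^sup>2 / 16 * c \<le> V x" if x: "x \<in> ball y r" for x
  proof -
    define m where "m = convolve \<nu> f x"
    have *: "\<kappa>\<^sup>2 / 16 * c \<le> V x" if a'': "a'' \<in> {a, b}" and far: "\<kappa> / 2 \<le> \<bar>f (y + a'') - m\<bar>" for a''
    proof -
      have "(\<kappa> / 4)\<^sup>2 \<le> (f (x + a') - m)\<^sup>2" if "a' \<in> ball a'' r" for a'
      proof -
        have "\<kappa> / 4 \<le> \<bar>f (x + a') - m\<bar>"
          using near[OF x that] far \<kappa> by linarith
        then show ?thesis
          using \<kappa> power_mono[of "\<kappa> / 4" "\<bar>f (x + a') - m\<bar>" 2] by simp
      qed
      then have "(\<kappa> / 4)\<^sup>2 * measure \<nu> (ball a'' r) \<le> V x"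
        unfolding V_def m_def
        by (intro integral_ge_measure borel_prob_measuresD(1)[OF \<nu>] integrable_continuous \<nu>
             continuous_intros continuous_on_translate fc) auto
      moreover have "(\<kappa> / 4)\<^sup>2 * c \<le> (\<kappa> / 4)\<^sup>2 * measure \<nu> (ball a'' r)"
        using a'' c by (intro mult_left_mono) auto
      ultimately show ?thesis by (simp add: power_divide)
    qed
    have "\<kappa> / 2 \<le> \<bar>f (y + a) - m\<bar> \<or> \<kappa> / 2 \<le> \<bar>f (y + b) - m\<bar>"
      using z by linarith
    then show ?thesis using * by blast
  qed
  have "\<kappa>\<^sup>2 / 16 * c * measure h (ball y r) \<le> (\<integral>x. V x \<partial>h)"
    using Vge V0 energy_loss_eq_variance(2)[OF h \<nu> fc]
    by (intro integral_ge_measure borel_prob_measuresD(1)[OF is_haarD(1)[OF h]]) (auto simp: V_def)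
  then show ?thesis
    using energy_loss_eq_variance(1)[OF h \<nu> fc] by (simp add: V_def)
qed

section \<open>Compactness and strict aperiodicity\<close>

text \<open>
  The bound \<open>\<eta>\<close> is uniform over all measures in \<open>W\<close> and all functions with modulus \<open>\<delta>\<close> that satisfy
  \<open>P\<close>; here \<open>P\<close> says that the function varies by at least a given amount in some specified
  way.
\<close>
definition uniform_loss ::
  "'a::compact_metric_ab_group measure \<Rightarrow> (real \<Rightarrow> real) \<Rightarrow> 'a measure set \<Rightarrow> (('a \<Rightarrow> real) \<Rightarrow> bool) \<Rightarrow> bool"
  where
  "uniform_loss h \<delta> W P \<longleftrightarrow>
     (\<exists>\<eta>>0. \<forall>\<nu>\<in>W. \<forall>f. has_modulus \<delta> f \<longrightarrow> P f \<longrightarrow> energy_loss h \<nu> f \<ge> \<eta>)"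

text \<open>
  The version on a weak-* neighbourhood of \<open>\<nu>\<close>, which compactness of \<open>K\<close> later turns into a bound uniform
  over \<open>K\<close>.
\<close>
definition locally_uniform_loss ::
  "'a::compact_metric_ab_group measure \<Rightarrow> (real \<Rightarrow> real) \<Rightarrow> 'a measure \<Rightarrow> (('a \<Rightarrow> real) \<Rightarrow> bool) \<Rightarrow> bool"
  where
  "locally_uniform_loss h \<delta> \<nu> P \<longleftrightarrow> (\<exists>W. openin weak_star W \<and> \<nu> \<in> W \<and> uniform_loss h \<delta> W P)"

lemma uniform_loss_mono:
  assumes "uniform_loss h \<delta> W P" "W' \<subseteq> W" "\<And>f. has_modulus \<delta> f \<Longrightarrow> P' f \<Longrightarrow> P f"
  shows "uniform_loss h \<delta> W' P'"
proof -
  obtain \<eta> where \<eta>: "\<eta> > 0"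
    "\<And>\<nu> f. \<nu> \<in> W \<Longrightarrow> has_modulus \<delta> f \<Longrightarrow> P f \<Longrightarrow> energy_loss h \<nu> f \<ge> \<eta>"
    using assms(1) unfolding uniform_loss_def by blast
  have "energy_loss h \<nu> f \<ge> \<eta>" if "\<nu> \<in> W'" "has_modulus \<delta> f" "P' f" for \<nu> f
    by (rule \<eta>(2)[OF subsetD[OF assms(2) that(1)] that(2) assms(3)[OF that(2,3)]])
  with \<eta>(1) show ?thesis unfolding uniform_loss_def by blast
qed

lemma uniform_loss_Un:
  assumes "uniform_loss h \<delta> W P" "uniform_loss h \<delta> W' P'"
    and "\<And>\<nu> f. \<nu> \<in> V \<Longrightarrow> has_modulus \<delta> f \<Longrightarrow> Q f \<Longrightarrow> \<nu> \<in> W \<and> P f \<or> \<nu> \<in> W' \<and> P' f"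
  shows "uniform_loss h \<delta> V Q"
proof -
  obtain \<eta> \<eta>' where *: "\<eta> > 0" "\<eta>' > 0"
    "\<And>\<nu> f. \<nu> \<in> W \<Longrightarrow> has_modulus \<delta> f \<Longrightarrow> P f \<Longrightarrow> energy_loss h \<nu> f \<ge> \<eta>"
    "\<And>\<nu> f. \<nu> \<in> W' \<Longrightarrow> has_modulus \<delta> f \<Longrightarrow> P' f \<Longrightarrow> energy_loss h \<nu> f \<ge> \<eta>'"
    using assms(1,2) unfolding uniform_loss_def by metis
  have "energy_loss h \<nu> f \<ge> min \<eta> \<eta>'" if "\<nu> \<in> V" "has_modulus \<delta> f" "Q f" for \<nu> f
    using assms(3)[OF that] *(3,4)[OF _ that(2)] by fastforce
  with *(1,2) show ?thesis
    unfolding uniform_loss_def by (intro exI[of _ "min \<eta> \<eta>'"]) auto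
qed

lemma locally_uniform_loss_mono:
  assumes "locally_uniform_loss h \<delta> \<nu> P" "\<And>f. has_modulus \<delta> f \<Longrightarrow> P' f \<Longrightarrow> P f"
  shows "locally_uniform_loss h \<delta> \<nu> P'"
proof -
  obtain W where W: "openin weak_star W" "\<nu> \<in> W" "uniform_loss h \<delta> W P"
    using assms(1) unfolding locally_uniform_loss_def by blast
  have "uniform_loss h \<delta> W P'"
    by (rule uniform_loss_mono[OF W(3) subset_refl assms(2)])
  with W(1,2) show ?thesis unfolding locally_uniform_loss_def by blast
qed

lemma locally_uniform_loss_disj:
  assumes "locally_uniform_loss h \<delta> \<nu> P" "locally_uniform_loss h \<delta> \<nu> Q"
  shows "locally_uniform_loss h \<delta> \<nu> (\<lambda>f. P f \<or> Q f)"
proof -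
  obtain V W where *: "openin weak_star V" "\<nu> \<in> V" "uniform_loss h \<delta> V P"
    "openin weak_star W" "\<nu> \<in> W" "uniform_loss h \<delta> W Q"
    using assms unfolding locally_uniform_loss_def by blast
  have "uniform_loss h \<delta> (V \<inter> W) (\<lambda>f. P f \<or> Q f)"
    by (rule uniform_loss_Un[OF *(3,6)]) auto
  moreover have "openin weak_star (V \<inter> W)" "\<nu> \<in> V \<inter> W"
    using * by auto
  ultimately show ?thesis
    unfolding locally_uniform_loss_def by blast
qed

lemma locally_uniform_loss_finite_disj:
  assumes "finite T" "\<nu> \<in> borel_prob_measures" "\<And>s. s \<in> T \<Longrightarrow> locally_uniform_loss h \<delta> \<nu> (P s)"
  shows "locally_uniform_loss h \<delta> \<nu> (\<lambda>f. \<exists>s\<in>T. P s f)"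
  using assms(1,3)
proof (induction T rule: finite_induct)
  case empty
  have "uniform_loss h \<delta> borel_prob_measures (\<lambda>f. False)"
    unfolding uniform_loss_def by (intro exI[of _ 1]) auto
  then show ?case
    unfolding locally_uniform_loss_def using assms(2) openin_topspace[of weak_star]
    by (intro exI[of _ borel_prob_measures]) simp
next
  case (insert s T)
  then show ?case
    using locally_uniform_loss_disj[of h \<delta> \<nu> "P s" "\<lambda>f. \<exists>s\<in>T. P s f"] by simp
qed

lemma openin_weak_star_integral_gt:
  fixes u :: "'a::compact_metric_ab_group \<Rightarrow> real"
  assumes "continuous_on UNIV u"
  shows "openin weak_star {\<nu> \<in> borel_prob_measures. (\<integral>y. u y \<partial>\<nu>) > c}"
proof -
  have "{\<nu> \<in> borel_prob_measures. (\<integral>y. u y \<partial>\<nu>) > c}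
      = {\<nu> \<in> borel_prob_measures. (\<integral>y. u y \<partial>\<nu>) \<in> {c<..}}" by auto
  moreover have "openin weak_star {\<nu> \<in> borel_prob_measures. (\<integral>y. u y \<partial>\<nu>) \<in> {c<..}}"
    unfolding weak_star_def
    by (intro topology_generated_by_Basis CollectI exI[of _ u] exI[of _ "{c<..}"])
      (simp add: assms)
  ultimately show ?thesis by simp
qed

lemma topological_support_ball_pos:
  fixes \<nu> :: "'a::compact_metric_ab_group measure"
  assumes \<nu>: "\<nu> \<in> borel_prob_measures" and a: "a \<in> topological_support \<nu>" and r: "r > 0"
  shows "measure \<nu> (ball a r) > 0"
proof (rule ccontr)
  assume "\<not> measure \<nu> (ball a r) > 0"
  then have z: "measure \<nu> (ball a r) = 0" by (simp add: less_le)
  interpret prob_space \<nu> by (rule borel_prob_measuresD(1)[OF \<nu>])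
  have "measure \<nu> (- ball a r) = 1"
    using prob_compl[of "ball a r"] z borel_prob_measuresD(2,3)[OF \<nu>]
    by (simp add: Compl_eq_Diff_UNIV)
  moreover have "closed (- ball a r)"
    by (intro closed_Compl open_ball)
  ultimately have "a \<in> - ball a r"
    using a unfolding topological_support_def by blast
  moreover have "a \<in> ball a r" using r by simp
  ultimately show False by blast
qed

text \<open>
  Balls are not continuity sets, but the tent function below the indicator of the ball is
  continuous, and its integral is positive at \<open>\<nu>\<close> because \<open>a\<close> lies in the support.
\<close>
lemma ball_mass_lower_semicontinuous:
  fixes \<nu> :: "'a::compact_metric_ab_group measure"
  assumes \<nu>: "\<nu> \<in> borel_prob_measures" and a: "a \<in> topological_support \<nu>" and r: "r > 0"
  obtains W c where "openin weak_star W" "\<nu> \<in> W" "c > 0"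
    "\<forall>\<nu>'\<in>W. measure \<nu>' (ball a r) \<ge> c"
proof -
  define u where "u y = max 0 (1 - dist y a / r)" for y
  have u: "continuous_on UNIV u"
    unfolding u_def using r by (intro continuous_intros) auto
  have u0: "u y \<ge> 0" for y by (simp add: u_def)
  have u1: "u y \<le> indicator (ball a r) y" for y
    using r by (auto simp: u_def indicator_def dist_commute)
  have u_half: "u y \<ge> 1 / 2" if "y \<in> ball a (r / 2)" for y
    using that r by (auto simp: u_def dist_commute field_simps)
  have le: "(\<integral>y. u y \<partial>\<nu>') \<le> measure \<nu>' (ball a r)" if \<nu>': "\<nu>' \<in> borel_prob_measures" for \<nu>'
  proof -
    interpret prob_space \<nu>' by (rule borel_prob_measuresD(1)[OF \<nu>'])
    have "(\<integral>y. u y \<partial>\<nu>') \<le> (\<integral>y. indicator (ball a r) y \<partial>\<nu>')"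
      using u1 borel_prob_measuresD(2)[OF \<nu>']
      by (intro integral_mono integrable_continuous \<nu>' u integrable_real_indicator)
        (auto simp: emeasure_eq_measure)
    then show ?thesis using borel_prob_measuresD(3)[OF \<nu>'] by simp
  qed
  have "1 / 2 * measure \<nu> (ball a (r / 2)) \<le> (\<integral>y. u y \<partial>\<nu>)"
    using u0 u_half borel_prob_measuresD(2)[OF \<nu>]
    by (intro integral_ge_measure borel_prob_measuresD(1)[OF \<nu>] integrable_continuous \<nu> u) auto
  then have pos: "(\<integral>y. u y \<partial>\<nu>) > 0"
    using topological_support_ball_pos[OF \<nu> a, of "r / 2"] r by simp
  define c where "c = (\<integral>y. u y \<partial>\<nu>) / 2"
  show thesis
  proof (rule that)
    show "openin weak_star {\<nu>' \<in> borel_prob_measures. (\<integral>y. u y \<partial>\<nu>') > c}"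
      by (rule openin_weak_star_integral_gt[OF u])
    show "\<nu> \<in> {\<nu>' \<in> borel_prob_measures. (\<integral>y. u y \<partial>\<nu>') > c}" "c > 0"
      using pos \<nu> by (auto simp: c_def)
    show "\<forall>\<nu>'\<in>{\<nu>' \<in> borel_prob_measures. (\<integral>y. u y \<partial>\<nu>') > c}. measure \<nu>' (ball a r) \<ge> c"
      using le by fastforce
  qed
qed

lemma locally_uniform_loss_difference:
  fixes \<nu> :: "'a::compact_metric_ab_group measure"
  assumes h: "is_haar h" and \<nu>: "\<nu> \<in> borel_prob_measures"
    and ab: "a \<in> topological_support \<nu>" "b \<in> topological_support \<nu>" and \<kappa>: "\<kappa> > 0"
    and pos: "\<And>e. e > 0 \<Longrightarrow> \<delta> e > 0"
  shows "locally_uniform_loss h \<delta> \<nu> (\<lambda>f. \<exists>z. \<bar>f (z + (a - b)) - f z\<bar> \<ge> \<kappa>)"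
proof -
  define r where "r = \<delta> (\<kappa> / 8) / 2"
  have r: "r > 0" using pos[of "\<kappa> / 8"] \<kappa> by (simp add: r_def)
  obtain V c where V: "openin weak_star V" "\<nu> \<in> V" "c > 0"
      "\<forall>\<nu>'\<in>V. measure \<nu>' (ball a r) \<ge> c"
    by (rule ball_mass_lower_semicontinuous[OF \<nu> ab(1) r]) (rule that)
  obtain W d where W: "openin weak_star W" "\<nu> \<in> W" "d > 0"
      "\<forall>\<nu>'\<in>W. measure \<nu>' (ball b r) \<ge> d"
    by (rule ball_mass_lower_semicontinuous[OF \<nu> ab(2) r]) (rule that)
  obtain q where q: "q > 0" "\<forall>y. measure h (ball y r) = q"
    by (rule haar_ball_pos[OF h r]) (rule that)
  have "energy_loss h \<nu>' f \<ge> \<kappa>\<^sup>2 / 16 * min c d * q"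
    if "\<nu>' \<in> V \<inter> W" and f: "has_modulus \<delta> f" and z: "\<bar>f (z + (a - b)) - f z\<bar> \<ge> \<kappa>" for \<nu>' f z
  proof -
    have "\<nu>' \<in> borel_prob_measures"
      using that(1) openin_subset[OF V(1)] by auto
    \<comment> \<open>Seen from \<open>z - b\<close>, the points \<open>z + (a - b)\<close> and \<open>z\<close> are the translates by \<open>a\<close> and \<open>b\<close>.\<close>
    moreover have "\<bar>f ((z - b) + a) - f ((z - b) + b)\<bar> \<ge> \<kappa>"
      using z by (simp add: algebra_simps)
    moreover have "min c d \<le> measure \<nu>' (ball a r)" "min c d \<le> measure \<nu>' (ball b r)"
      using that(1) V(4) W(4) by (auto simp: min.coboundedI1 min.coboundedI2)
    ultimately show ?thesis
      using energy_loss_ge[OF h _ f \<kappa>, of \<nu>' r "z - b" a b "min c d"] q(2)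
      by (simp add: r_def)
  qed
  then have "uniform_loss h \<delta> (V \<inter> W) (\<lambda>f. \<exists>z. \<bar>f (z + (a - b)) - f z\<bar> \<ge> \<kappa>)"
    unfolding uniform_loss_def using V(3) W(3) q(1) \<kappa>
    by (intro exI[of _ "\<kappa>\<^sup>2 / 16 * min c d * q"]) auto
  moreover have "openin weak_star (V \<inter> W)" "\<nu> \<in> V \<inter> W"
    using V(1,2) W(1,2) by auto
  ultimately show ?thesis
    unfolding locally_uniform_loss_def by blast
qed

text \<open>
  Variation by \<open>\<kappa>\<close> along \<open>s + t\<close> forces variation by \<open>\<kappa> / 2\<close> along \<open>s\<close> or along \<open>t\<close>. Quantifying
  over all \<open>\<kappa>\<close> thus makes the property of \<open>s\<close> closed under addition, and it passes from the
  differences of support points to the semigroup that they generate.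
\<close>
lemma locally_uniform_loss_hull:
  fixes \<nu> :: "'a::compact_metric_ab_group measure"
  assumes h: "is_haar h" and \<nu>: "\<nu> \<in> borel_prob_measures"
    and s: "s \<in> add_closed hull {a - b |a b. a \<in> topological_support \<nu> \<and> b \<in> topological_support \<nu>}"
    and \<kappa>: "\<kappa> > 0"
    and pos: "\<And>e. e > 0 \<Longrightarrow> \<delta> e > 0"
  shows "locally_uniform_loss h \<delta> \<nu> (\<lambda>f. \<exists>z. \<bar>f (z + s) - f z\<bar> \<ge> \<kappa>)"
proof -
  have "\<forall>\<kappa>>0. locally_uniform_loss h \<delta> \<nu> (\<lambda>f. \<exists>z. \<bar>f (z + s) - f z\<bar> \<ge> \<kappa>)" (is "?Q s")
    using s
  proof (rule hull_induct)
    show "?Q s" if s: "s \<in> {a - b |a b. a \<in> topological_support \<nu> \<and> b \<in> topological_support \<nu>}" for s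
    proof -
      obtain a b where "s = a - b" "a \<in> topological_support \<nu>" "b \<in> topological_support \<nu>"
        using s by blast
      then show ?thesis
        using locally_uniform_loss_difference[OF h \<nu> _ _ _ pos, of a b] by simp
    qed
    have "?Q (s + t)" if "?Q s" "?Q t" for s t
    proof (intro allI impI)
      fix \<kappa> :: real assume "\<kappa> > 0"
      then have "\<kappa> / 2 > 0" by simp
      then have "locally_uniform_loss h \<delta> \<nu>
          (\<lambda>f. (\<exists>z. \<bar>f (z + s) - f z\<bar> \<ge> \<kappa> / 2) \<or> (\<exists>z. \<bar>f (z + t) - f z\<bar> \<ge> \<kappa> / 2))"
        using that by (intro locally_uniform_loss_disj) blast+
      then show "locally_uniform_loss h \<delta> \<nu> (\<lambda>f. \<exists>z. \<bar>f (z + (s + t)) - f z\<bar> \<ge> \<kappa>)"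
      proof (rule locally_uniform_loss_mono)
        fix f :: "'a \<Rightarrow> real" assume "\<exists>z. \<bar>f (z + (s + t)) - f z\<bar> \<ge> \<kappa>"
        then obtain z where "\<bar>f (z + s + t) - f z\<bar> \<ge> \<kappa>" by (auto simp: add.assoc)
        then have "\<bar>f (z + s) - f z\<bar> \<ge> \<kappa> / 2 \<or> \<bar>f (z + s + t) - f (z + s)\<bar> \<ge> \<kappa> / 2"
          by linarith
        then show "(\<exists>z. \<bar>f (z + s) - f z\<bar> \<ge> \<kappa> / 2) \<or> (\<exists>z. \<bar>f (z + t) - f z\<bar> \<ge> \<kappa> / 2)"
          by blast
      qed
    qed
    then show "add_closed {s. ?Q s}" unfolding add_closed_def by blast
  qed
  with \<kappa> show ?thesis by blast
qed

text \<open>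
  Strict aperiodicity enters here. The semigroup is dense, so by compactness of the group finitely
  many of its elements form an \<open>r\<close>-net. If \<open>f\<close> oscillates by \<open>\<kappa>\<close> between \<open>x\<close> and \<open>y\<close>, then it varies by
  at least \<open>\<kappa> / 2\<close> along a net element close to \<open>x - y\<close>.
\<close>
lemma locally_uniform_loss_oscillation:
  fixes \<nu> :: "'a::compact_metric_ab_group measure"
  assumes h: "is_haar h" and \<nu>: "\<nu> \<in> borel_prob_measures" and ap: "strictly_aperiodic \<nu>"
    and \<kappa>: "\<kappa> > 0"
    and pos: "\<And>e. e > 0 \<Longrightarrow> \<delta> e > 0"
  shows "locally_uniform_loss h \<delta> \<nu> (\<lambda>f. \<exists>x y. \<bar>f x - f y\<bar> \<ge> \<kappa>)"
proof -
  define r where "r = \<delta> (\<kappa> / 4)"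
  have r: "r > 0" using pos[of "\<kappa> / 4"] \<kappa> by (simp add: r_def)
  define S where "S = add_closed hull {a - b |a b. a \<in> topological_support \<nu> \<and> b \<in> topological_support \<nu>}"
  have "\<exists>s\<in>S. dist s t < r" for t
    using ap r closure_approachable[of t S] unfolding strictly_aperiodic_def S_def[symmetric] by simp
  then have "(UNIV :: 'a set) \<subseteq> (\<Union>s\<in>S. ball s r)" by fastforce
  then obtain T where T: "finite T" "T \<subseteq> S" "(UNIV :: 'a set) \<subseteq> (\<Union>s\<in>T. ball s r)"
    by (rule compactE_image[OF compact_UNIV_group, rotated]) auto
  have "locally_uniform_loss h \<delta> \<nu> (\<lambda>f. \<exists>s\<in>T. \<exists>z. \<bar>f (z + s) - f z\<bar> \<ge> \<kappa> / 2)"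
    using T(2) \<kappa> unfolding S_def
    by (intro locally_uniform_loss_finite_disj T(1) \<nu> locally_uniform_loss_hull[OF h] pos) auto
  then show ?thesis
  proof (rule locally_uniform_loss_mono)
    fix f :: "'a \<Rightarrow> real" assume f: "has_modulus \<delta> f" and "\<exists>x y. \<bar>f x - f y\<bar> \<ge> \<kappa>"
    then obtain x y where xy: "\<bar>f x - f y\<bar> \<ge> \<kappa>" by blast
    obtain s where s: "s \<in> T" "dist s (x - y) < r"
      using T(3) by (auto simp: subset_iff)
    have "dist (y + s) x = dist s (x - y)"
      using dist_add_left[of y s "x - y"] by simp
    then have "\<bar>f (y + s) - f x\<bar> \<le> \<kappa> / 4"
      using has_modulusD(2)[OF f, of "\<kappa> / 4" "y + s" x] s(2) \<kappa> by (simp add: r_def)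
    then have "\<bar>f (y + s) - f y\<bar> \<ge> \<kappa> / 2" using xy \<kappa> by linarith
    with s(1) show "\<exists>s\<in>T. \<exists>z. \<bar>f (z + s) - f z\<bar> \<ge> \<kappa> / 2" by blast
  qed
qed

lemma uniform_loss_compact:
  assumes K: "compactin weak_star K" and "\<And>\<nu>. \<nu> \<in> K \<Longrightarrow> locally_uniform_loss h \<delta> \<nu> P"
  shows "uniform_loss h \<delta> K P"
proof -
  define \<U> where "\<U> = {W. openin weak_star W \<and> uniform_loss h \<delta> W P}"
  have "K \<subseteq> \<Union>\<U>"
    using assms(2) unfolding \<U>_def locally_uniform_loss_def by blast
  then obtain \<F> where \<F>: "finite \<F>" "\<F> \<subseteq> \<U>" "K \<subseteq> \<Union>\<F>"
    using K unfolding compactin_def \<U>_def by (metis (no_types, lifting) mem_Collect_eq)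
  have "uniform_loss h \<delta> (\<Union>\<F>) P"
    using \<F>(1,2)
  proof (induction \<F> rule: finite_induct)
    case empty
    show ?case unfolding uniform_loss_def by (auto intro: exI[of _ 1])
  next
    case (insert W \<F>)
    then have "uniform_loss h \<delta> W P" "uniform_loss h \<delta> (\<Union>\<F>) P"
      by (auto simp: \<U>_def)
    then show ?case by (rule uniform_loss_Un) auto
  qed
  then show ?thesis by (rule uniform_loss_mono) (use \<F>(3) in auto)
qed

section \<open>Uniform convergence of composed averaging operators\<close>

lemma foldr_convolve_continuous:
  assumes "set \<nu>s \<subseteq> borel_prob_measures" "continuous_on UNIV \<phi>"
  shows "continuous_on UNIV (foldr convolve \<nu>s \<phi>)"
  using assms by (induction \<nu>s) (auto intro: continuous_convolve)

lemma foldr_convolve_has_modulus: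
  assumes "set \<nu>s \<subseteq> borel_prob_measures" "has_modulus \<delta> \<phi>"
  shows "has_modulus \<delta> (foldr convolve \<nu>s \<phi>)"
  using assms by (induction \<nu>s) (auto intro: has_modulus_convolve)

lemma foldr_convolve_bounded:
  assumes "set \<nu>s \<subseteq> borel_prob_measures" "continuous_on UNIV \<phi>" "\<And>x. \<bar>\<phi> x\<bar> \<le> B"
  shows "\<bar>foldr convolve \<nu>s \<phi> x\<bar> \<le> B"
  using assms(1)
proof (induction \<nu>s arbitrary: x)
  case Nil
  then show ?case using assms(3) by simp
next
  case (Cons \<nu> \<nu>s)
  let ?f = "foldr convolve \<nu>s \<phi>"
  have \<nu>: "\<nu> \<in> borel_prob_measures" using Cons.prems by simp
  have c: "continuous_on UNIV ?f"
    using Cons.prems by (intro foldr_convolve_continuous assms) auto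
  have "\<bar>?f y\<bar> \<le> B" for y using Cons by simp
  then have "- B \<le> ?f y" "?f y \<le> B" for y by (simp_all add: abs_le_iff minus_le_iff)
  then have "convolve \<nu> (\<lambda>_. - B) x \<le> convolve \<nu> ?f x" "convolve \<nu> ?f x \<le> convolve \<nu> (\<lambda>_. B) x"
    by (intro convolve_mono \<nu> c continuous_on_const; blast)+
  then show ?case using \<nu> by (simp add: abs_le_iff)
qed

lemma integral_haar_foldr_convolve:
  assumes "is_haar h" "set \<nu>s \<subseteq> borel_prob_measures" "continuous_on UNIV \<phi>"
  shows "(\<integral>x. foldr convolve \<nu>s \<phi> x \<partial>h) = (\<integral>x. \<phi> x \<partial>h)"
  using assms(2)
proof (induction \<nu>s)
  case (Cons \<nu> \<nu>s)
  then show ?case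
    using integral_convolve_haar[OF assms(1) _ foldr_convolve_continuous[OF _ assms(3)], of \<nu> \<nu>s] by simp
qed simp

lemma deviation_from_haar_mean_le:
  fixes f :: "'a::compact_metric_ab_group \<Rightarrow> real"
  assumes h: "is_haar h" and f: "continuous_on UNIV f" and "\<And>x y. \<bar>f x - f y\<bar> \<le> \<kappa>"
  shows "\<bar>f x - (\<integral>y. f y \<partial>h)\<bar> \<le> \<kappa>"
proof -
  interpret prob_space h by (rule borel_prob_measuresD(1)[OF is_haarD(1)[OF h]])
  have i: "integrable h f" by (rule integrable_continuous[OF is_haarD(1)[OF h] f])
  have "f x - (\<integral>y. f y \<partial>h) = (\<integral>y. f x - f y \<partial>h)" using i prob_space by simp
  also have "\<bar>\<dots>\<bar> \<le> (\<integral>y. \<bar>f x - f y\<bar> \<partial>h)" by (rule integral_abs_bound)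
  also have "\<dots> \<le> (\<integral>y. \<kappa> \<partial>h)" using i assms(3) by (intro integral_mono) auto
  finally show ?thesis using prob_space by simp
qed

text \<open>
  Each averaging step either starts from a function of oscillation at most \<open>\<kappa>\<close>, a property that all
  later steps keep, or it costs at least \<open>\<eta>\<close> of energy. The energy of \<open>\<phi>\<close> pays for finitely many
  steps of the second kind only, and their number does not depend on the measures. Since averaging
  preserves the Haar mean, small oscillation means closeness to that mean.
\<close>
lemma foldr_convolve_tendsto_uniformly:
  fixes h :: "'a::compact_metric_ab_group measure"
  assumes h: "is_haar h" and K: "compactin weak_star K" and ap: "\<forall>\<nu>\<in>K. strictly_aperiodic \<nu>"
    and \<phi>: "continuous_on UNIV \<phi>" and \<kappa>: "\<kappa> > 0"
  obtains N where "\<And>\<nu>s x. set \<nu>s \<subseteq> K \<Longrightarrow> length \<nu>s \<ge> N \<Longrightarrow>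
    \<bar>foldr convolve \<nu>s \<phi> x - (\<integral>y. \<phi> y \<partial>h)\<bar> \<le> \<kappa>"
proof -
  have KB: "K \<subseteq> borel_prob_measures"
    using compactin_subset_topspace[OF K] by simp
  obtain \<delta> where \<delta>: "has_modulus \<delta> \<phi>" using continuous_has_modulus[OF \<phi>] .
  have "uniform_loss h \<delta> K (\<lambda>f. \<exists>x y. \<bar>f x - f y\<bar> \<ge> \<kappa>)"
    using KB ap by (intro uniform_loss_compact K locally_uniform_loss_oscillation h \<kappa>
        has_modulusD(1)[OF \<delta>]) auto
  then obtain \<eta> where \<eta>: "\<eta> > 0"
    "\<And>\<nu> f x y. \<nu> \<in> K \<Longrightarrow> has_modulus \<delta> f \<Longrightarrow> \<bar>f x - f y\<bar> \<ge> \<kappa> \<Longrightarrow> energy_loss h \<nu> f \<ge> \<eta>"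
    unfolding uniform_loss_def by blast
  define E where "E = (\<integral>x. (\<phi> x)\<^sup>2 \<partial>h)"
  have step: "(\<forall>x y. \<bar>foldr convolve \<nu>s \<phi> x - foldr convolve \<nu>s \<phi> y\<bar> \<le> \<kappa>) \<or>
      (\<integral>x. (foldr convolve \<nu>s \<phi> x)\<^sup>2 \<partial>h) \<le> E - real (length \<nu>s) * \<eta>" if "set \<nu>s \<subseteq> K" for \<nu>s
    using that
  proof (induction \<nu>s)
    case Nil
    then show ?case by (simp add: E_def)
  next
    case (Cons \<nu> \<nu>s)
    let ?f = "foldr convolve \<nu>s \<phi>"
    have \<nu>: "\<nu> \<in> K" "\<nu> \<in> borel_prob_measures" using Cons.prems KB by auto
    have m: "has_modulus \<delta> ?f"
      using Cons.prems KB by (intro foldr_convolve_has_modulus \<delta>) auto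
    show ?case
    proof (cases "\<forall>x y. \<bar>?f x - ?f y\<bar> \<le> \<kappa>")
      case True
      then have "\<bar>convolve \<nu> ?f x - convolve \<nu> ?f y\<bar> \<le> \<kappa>" for x y
        by (intro convolve_diff_le \<nu>(2) has_modulus_continuous[OF m]) auto
      then show ?thesis by simp
    next
      case False
      then obtain x y where "\<bar>?f x - ?f y\<bar> \<ge> \<kappa>" by (meson linear)
      from \<eta>(2)[OF \<nu>(1) m this] have "energy_loss h \<nu> ?f \<ge> \<eta>" .
      moreover have "(\<integral>x. (?f x)\<^sup>2 \<partial>h) \<le> E - real (length \<nu>s) * \<eta>"
        using Cons False by auto
      ultimately show ?thesis by (simp add: energy_loss_def algebra_simps)
    qed
  qed
  obtain N :: nat where N: "real N * \<eta> > E"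
    using reals_Archimedean3[OF \<eta>(1)] by blast
  show thesis
  proof (rule that)
    fix \<nu>s x assume \<nu>s: "set \<nu>s \<subseteq> K" "length \<nu>s \<ge> N"
    let ?f = "foldr convolve \<nu>s \<phi>"
    have "0 \<le> (\<integral>x. (?f x)\<^sup>2 \<partial>h)" by (intro integral_nonneg_AE) auto
    moreover have "real (length \<nu>s) * \<eta> \<ge> real N * \<eta>"
      using \<nu>s(2) \<eta>(1) by (intro mult_right_mono) auto
    ultimately have "\<not> (\<integral>x. (?f x)\<^sup>2 \<partial>h) \<le> E - real (length \<nu>s) * \<eta>"
      using N by linarith
    then have "\<bar>?f x - ?f y\<bar> \<le> \<kappa>" for x y
      using step[OF \<nu>s(1)] by blast
    then have "\<bar>?f x - (\<integral>y. ?f y \<partial>h)\<bar> \<le> \<kappa>"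
      using \<nu>s(1) KB by (intro deviation_from_haar_mean_le h foldr_convolve_continuous \<phi>) auto
    then show "\<bar>?f x - (\<integral>y. \<phi> y \<partial>h)\<bar> \<le> \<kappa>"
      using integral_haar_foldr_convolve[OF h _ \<phi>, of \<nu>s] \<nu>s(1) KB by auto
  qed
qed

section \<open>Exponential moments of the ergodic sums\<close>

text \<open>
  For a walk with independent steps of laws \<open>\<nu>s = [\<nu>1, \<dots>, \<nu>n]\<close> this is the expectation of
  \<open>exp (s * (\<phi> x + \<phi> (x + \<alpha>1) + \<dots> + \<phi> (x + \<alpha>1 + \<dots> + \<alpha>(n - 1))))\<close>, computed by conditioning on the
  first step. The sum has as many terms as the list has entries, so it does not see the last
  step.
\<close>
primrec exp_moment ::
  "real \<Rightarrow> ('a::compact_metric_ab_group \<Rightarrow> real) \<Rightarrow> 'a measure list \<Rightarrow> 'a \<Rightarrow> real" where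
  "exp_moment s \<phi> [] = (\<lambda>x. 1)"
| "exp_moment s \<phi> (\<nu> # \<nu>s) = (\<lambda>x. exp (s * \<phi> x) * convolve \<nu> (exp_moment s \<phi> \<nu>s) x)"

text \<open>
  The expectation of the sum that \<open>exp_moment\<close> multiplies by \<open>s\<close> and exponentiates.
\<close>
definition expected_sum ::
  "('a::compact_metric_ab_group \<Rightarrow> real) \<Rightarrow> 'a measure list \<Rightarrow> 'a \<Rightarrow> real" where
  "expected_sum \<phi> \<nu>s x = (\<Sum>k<length \<nu>s. foldr convolve (take k \<nu>s) \<phi> x)"

lemma exp_moment_continuous:
  assumes "set \<nu>s \<subseteq> borel_prob_measures" "continuous_on UNIV \<phi>"
  shows "continuous_on UNIV (exp_moment s \<phi> \<nu>s)"
  using assms by (induction \<nu>s) (auto intro!: continuous_intros continuous_convolve)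

lemma convolve_nonneg: "(\<And>x. f x \<ge> 0) \<Longrightarrow> convolve \<nu> f x \<ge> 0"
  unfolding convolve_def by (intro integral_nonneg_AE) auto

lemma exp_moment_nonneg: "exp_moment s \<phi> \<nu>s x \<ge> 0"
  by (induction \<nu>s arbitrary: x) (auto intro!: mult_nonneg_nonneg convolve_nonneg)

text \<open>
  The Markov property: the later steps contribute at most the factor \<open>c\<close>, wherever the earlier
  steps lead.
\<close>
lemma exp_moment_append_le:
  assumes "set \<nu>s \<subseteq> borel_prob_measures" "set \<nu>s' \<subseteq> borel_prob_measures" "continuous_on UNIV \<phi>"
    and "\<And>x. exp_moment s \<phi> \<nu>s' x \<le> c"
  shows "exp_moment s \<phi> (\<nu>s @ \<nu>s') x \<le> c * exp_moment s \<phi> \<nu>s x"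
  using assms(1)
proof (induction \<nu>s arbitrary: x)
  case Nil
  then show ?case using assms(4) by simp
next
  case (Cons \<nu> \<nu>s)
  have \<nu>: "\<nu> \<in> borel_prob_measures" "set \<nu>s \<subseteq> borel_prob_measures" using Cons.prems by auto
  have "convolve \<nu> (exp_moment s \<phi> (\<nu>s @ \<nu>s')) x \<le> convolve \<nu> (\<lambda>x. c * exp_moment s \<phi> \<nu>s x) x"
    using \<nu> Cons.IH assms(2,3)
    by (intro convolve_mono exp_moment_continuous continuous_intros) auto
  also have "\<dots> = c * convolve \<nu> (exp_moment s \<phi> \<nu>s) x"
    by (simp add: convolve_def)
  finally show ?case by (simp add: mult.left_commute)
qed

lemma exp_moment_le_exp:
  assumes "set \<nu>s \<subseteq> borel_prob_measures" "continuous_on UNIV \<phi>" "\<And>x. \<bar>\<phi> x\<bar> \<le> B" "s \<ge> 0"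
  shows "exp_moment s \<phi> \<nu>s x \<le> exp (s * B * real (length \<nu>s))"
  using assms(1)
proof (induction \<nu>s arbitrary: x)
  case (Cons \<nu> \<nu>s)
  have \<nu>: "\<nu> \<in> borel_prob_measures" "set \<nu>s \<subseteq> borel_prob_measures" using Cons.prems by auto
  let ?c = "exp (s * B * real (length \<nu>s))"
  have "convolve \<nu> (exp_moment s \<phi> \<nu>s) x \<le> convolve \<nu> (\<lambda>_. ?c) x"
    using \<nu> Cons.IH assms(2)
    by (intro convolve_mono exp_moment_continuous continuous_intros) auto
  then have "convolve \<nu> (exp_moment s \<phi> \<nu>s) x \<le> ?c" using \<nu> by simp
  moreover have "exp (s * \<phi> x) \<le> exp (s * B)"
    using assms(3)[of x] assms(4) by (auto intro!: mult_left_mono)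
  ultimately have "exp_moment s \<phi> (\<nu> # \<nu>s) x \<le> exp (s * B) * ?c"
    by (auto intro!: mult_mono convolve_nonneg exp_moment_nonneg)
  then show ?case by (simp add: exp_add [symmetric] algebra_simps)
qed simp

lemma exp_le_quadratic:
  fixes u :: real
  assumes "\<bar>u\<bar> \<le> 1"
  shows "exp u \<le> 1 + u + u\<^sup>2"
proof (cases "u \<ge> 0")
  case True
  then show ?thesis using exp_bound[of u] assms by simp
next
  case False
  define v where "v = - u"
  have v: "0 \<le> v" "v \<le> 1" using False assms by (auto simp: v_def)
  have "(1 - v + v\<^sup>2) * (1 + v + v\<^sup>2 / 2) - 1 = v\<^sup>2 * (1 / 2 + v / 2 + v\<^sup>2 / 2)"
    by (simp add: field_simps power2_eq_square)
  also have "\<dots> \<ge> 0" using v by simp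
  finally have "1 \<le> (1 - v + v\<^sup>2) * (1 + v + v\<^sup>2 / 2)" by simp
  also have "\<dots> \<le> (1 - v + v\<^sup>2) * exp v"
    using exp_lower_Taylor_quadratic[OF v(1)] v by (intro mult_left_mono) auto
  finally show ?thesis by (simp add: v_def exp_minus field_simps)
qed

lemma continuous_expected_sum:
  assumes "set \<nu>s \<subseteq> borel_prob_measures" "continuous_on UNIV \<phi>"
  shows "continuous_on UNIV (expected_sum \<phi> \<nu>s)"
  unfolding expected_sum_def using assms set_take_subset[of _ \<nu>s]
  by (intro continuous_intros foldr_convolve_continuous) blast+

lemma expected_sum_Cons:
  assumes "\<nu> \<in> borel_prob_measures" "set \<nu>s \<subseteq> borel_prob_measures" "continuous_on UNIV \<phi>"
  shows "expected_sum \<phi> (\<nu> # \<nu>s) x = \<phi> x + convolve \<nu> (expected_sum \<phi> \<nu>s) x"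
proof -
  have i: "integrable \<nu> (\<lambda>a. foldr convolve (take k \<nu>s) \<phi> (x + a))" for k
    using assms set_take_subset[of k \<nu>s]
    by (intro integrable_translate foldr_convolve_continuous) blast+
  have "convolve \<nu> (expected_sum \<phi> \<nu>s) x
      = (\<Sum>k<length \<nu>s. convolve \<nu> (foldr convolve (take k \<nu>s) \<phi>) x)"
    unfolding convolve_def[of \<nu>] expected_sum_def using i by simp
  then show ?thesis
    unfolding expected_sum_def[of _ "\<nu> # \<nu>s"] length_Cons sum.lessThan_Suc_shift by simp
qed

lemma abs_expected_sum_le:
  assumes "set \<nu>s \<subseteq> borel_prob_measures" "continuous_on UNIV \<phi>" "\<And>x. \<bar>\<phi> x\<bar> \<le> B"
  shows "\<bar>expected_sum \<phi> \<nu>s x\<bar> \<le> real (length \<nu>s) * B"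
proof -
  have "\<bar>expected_sum \<phi> \<nu>s x\<bar> \<le> (\<Sum>k<length \<nu>s. \<bar>foldr convolve (take k \<nu>s) \<phi> x\<bar>)"
    unfolding expected_sum_def by (rule sum_abs)
  also have "\<dots> \<le> (\<Sum>k<length \<nu>s. B)"
    using assms set_take_subset[of _ \<nu>s] by (intro sum_mono foldr_convolve_bounded) blast+
  finally show ?thesis by simp
qed

text \<open>
  The algebra of the induction step in \<open>exp_moment_le_second_order\<close>: all terms of order at least two
  in \<open>s\<close> are absorbed into one multiple of \<open>s\<^sup>2\<close>.
\<close>
lemma quadratic_product_le:
  fixes s p l B C m :: real
  assumes s: "s \<ge> 0" "s * B \<le> 1" and p: "\<bar>p\<bar> \<le> B" and l: "\<bar>l\<bar> \<le> m * B" and C: "C \<ge> 0"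
  shows "(1 + s * p + (s * p)\<^sup>2) * (1 + s * l + C * s\<^sup>2)
    \<le> 1 + s * (p + l) + (B\<^sup>2 + 2 * m * B\<^sup>2 + 3 * C) * s\<^sup>2"
proof -
  have B: "B \<ge> 0" using p by linarith
  have "s * \<bar>p\<bar> \<le> s * B" using p s(1) by (rule mult_left_mono)
  then have sp: "\<bar>s * p\<bar> \<le> 1" using s by (simp add: abs_mult)
  then have sp': "s * p \<le> 1" "(s * p)\<^sup>2 \<le> 1"
    by (auto simp: abs_square_le_1 abs_le_iff)
  have pp: "p\<^sup>2 \<le> B\<^sup>2" using p B by (simp add: abs_le_square_iff[symmetric])
  have "\<bar>p * l\<bar> \<le> B * (m * B)" unfolding abs_mult using p l by (intro mult_mono) auto
  then have pl: "\<bar>p * l\<bar> \<le> m * B\<^sup>2" by (simp add: power2_eq_square mult_ac)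
  then have "\<bar>s * p\<bar> * \<bar>p * l\<bar> \<le> 1 * (m * B\<^sup>2)" using sp by (intro mult_mono) auto
  then have spl: "s * p * (p * l) \<le> m * B\<^sup>2"
    using abs_ge_self[of "s * p * (p * l)"] by (simp add: abs_mult)
  have sC: "s * p * C \<le> C" "(s * p)\<^sup>2 * C \<le> C"
    using mult_right_mono[OF sp'(1) C] mult_right_mono[OF sp'(2) C] by auto
  have "p\<^sup>2 + p * l + C + s * p * (p * l) + s * p * C + (s * p)\<^sup>2 * C
      \<le> B\<^sup>2 + 2 * m * B\<^sup>2 + 3 * C"
    using pp pl spl sC by (simp add: abs_le_iff)
  from mult_right_mono[OF this zero_le_power2[of s]]
  show ?thesis by (simp add: algebra_simps power2_eq_square)
qed

text \<open>
  The quadratic error of the first-order expansion in \<open>s\<close> depends on the number \<open>m\<close> of steps and on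
  the bound of \<open>\<phi>\<close>, but neither on the measures nor on the starting point.
\<close>
lemma exp_moment_le_second_order:
  fixes \<phi> :: "'a::compact_metric_ab_group \<Rightarrow> real"
  assumes \<phi>: "continuous_on UNIV \<phi>" and B: "\<And>x. \<bar>\<phi> x\<bar> \<le> B"
  shows "\<exists>C\<ge>0. \<forall>s \<nu>s x. s \<ge> 0 \<longrightarrow> s * B \<le> 1 \<longrightarrow> set \<nu>s \<subseteq> borel_prob_measures \<longrightarrow> length \<nu>s = m \<longrightarrow>
    exp_moment s \<phi> \<nu>s x \<le> 1 + s * expected_sum \<phi> \<nu>s x + C * s\<^sup>2"
proof (induction m)
  case 0
  show ?case by (intro exI[of _ 0]) (auto simp: expected_sum_def)
next
  case (Suc m)
  then obtain C where C: "C \<ge> 0"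
    "\<And>s \<nu>s x. s \<ge> 0 \<Longrightarrow> s * B \<le> 1 \<Longrightarrow> set \<nu>s \<subseteq> borel_prob_measures \<Longrightarrow> length \<nu>s = m \<Longrightarrow>
      exp_moment s \<phi> \<nu>s x \<le> 1 + s * expected_sum \<phi> \<nu>s x + C * s\<^sup>2"
    by blast
  let ?C = "B\<^sup>2 + 2 * real m * B\<^sup>2 + 3 * C"
  have "exp_moment s \<phi> \<nu>s x \<le> 1 + s * expected_sum \<phi> \<nu>s x + ?C * s\<^sup>2"
    if s: "s \<ge> 0" "s * B \<le> 1" and "set \<nu>s \<subseteq> borel_prob_measures" "length \<nu>s = Suc m" for s \<nu>s x
  proof -
    obtain \<nu> \<nu>s' where eq: "\<nu>s = \<nu> # \<nu>s'" and len: "length \<nu>s' = m"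
      using \<open>length \<nu>s = Suc m\<close> by (cases \<nu>s) auto
    have \<nu>: "\<nu> \<in> borel_prob_measures" "set \<nu>s' \<subseteq> borel_prob_measures"
      using \<open>set \<nu>s \<subseteq> borel_prob_measures\<close> eq by auto
    interpret prob_space \<nu> by (rule borel_prob_measuresD(1)[OF \<nu>(1)])
    define l where "l = convolve \<nu> (expected_sum \<phi> \<nu>s') x"
    have cs: "continuous_on UNIV (expected_sum \<phi> \<nu>s')" by (intro continuous_expected_sum \<nu> \<phi>)
    have bd: "\<bar>expected_sum \<phi> \<nu>s' y\<bar> \<le> real m * B" for y
      using abs_expected_sum_le[OF \<nu>(2) \<phi> B] len by simp
    have l: "\<bar>l\<bar> \<le> real m * B"
      using foldr_convolve_bounded[of "[\<nu>]" "expected_sum \<phi> \<nu>s'", OF _ cs bd] \<nu>(1) by (simp add: l_def)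
    have "convolve \<nu> (exp_moment s \<phi> \<nu>s') x
        \<le> convolve \<nu> (\<lambda>y. 1 + s * expected_sum \<phi> \<nu>s' y + C * s\<^sup>2) x"
      using C(2)[OF s \<nu>(2) len]
      by (intro convolve_mono \<nu> exp_moment_continuous continuous_intros \<phi> cs) auto
    also have "\<dots> = 1 + s * l + C * s\<^sup>2"
      using integrable_translate[OF \<nu>(1) cs] by (simp add: convolve_def l_def prob_space)
    finally have 1: "convolve \<nu> (exp_moment s \<phi> \<nu>s') x \<le> 1 + s * l + C * s\<^sup>2" .
    have "\<bar>s * \<phi> x\<bar> \<le> 1"
      using mult_left_mono[OF B[of x] s(1)] s by (simp add: abs_mult)
    then have 2: "exp (s * \<phi> x) \<le> 1 + s * \<phi> x + (s * \<phi> x)\<^sup>2" by (rule exp_le_quadratic)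
    then have "exp_moment s \<phi> \<nu>s x \<le> (1 + s * \<phi> x + (s * \<phi> x)\<^sup>2) * (1 + s * l + C * s\<^sup>2)"
      unfolding eq exp_moment.simps
      using order_trans[OF exp_ge_zero 2]
      by (intro mult_mono 1 2 convolve_nonneg exp_moment_nonneg) auto
    also have "\<dots> \<le> 1 + s * (\<phi> x + l) + ?C * s\<^sup>2"
      by (rule quadratic_product_le[OF s B l C(1)])
    finally show ?thesis
      by (simp add: eq expected_sum_Cons[OF \<nu> \<phi>] l_def)
  qed
  moreover have "?C \<ge> 0" using C(1) by simp
  ultimately show ?case by (intro exI[of _ ?C]) blast
qed

text \<open>
  All but the first \<open>N\<close> terms of the expected sum are uniformly small, and those \<open>N\<close> terms are
  negligible relative to a large \<open>m\<close>.
\<close>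
lemma expected_sum_small:
  fixes h :: "'a::compact_metric_ab_group measure"
  assumes h: "is_haar h" and K: "compactin weak_star K" and ap: "\<forall>\<nu>\<in>K. strictly_aperiodic \<nu>"
    and \<phi>: "continuous_on UNIV \<phi>" and mean: "(\<integral>y. \<phi> y \<partial>h) = 0" and \<epsilon>: "\<epsilon> > 0"
  obtains m where "m \<ge> 1"
    "\<forall>\<nu>s x. set \<nu>s \<subseteq> K \<longrightarrow> length \<nu>s = m \<longrightarrow> expected_sum \<phi> \<nu>s x \<le> \<epsilon> * real m"
proof -
  have KB: "K \<subseteq> borel_prob_measures"
    using compactin_subset_topspace[OF K] by simp
  obtain B where B: "B > 0" "\<And>x. \<bar>\<phi> x\<bar> \<le> B" using continuous_bounded[OF \<phi>] by blast
  have "\<epsilon> / 2 > 0" using \<epsilon> by simp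
  from foldr_convolve_tendsto_uniformly[OF h K ap \<phi> this]
  obtain N where N: "\<And>\<nu>s x. set \<nu>s \<subseteq> K \<Longrightarrow> length \<nu>s \<ge> N \<Longrightarrow> \<bar>foldr convolve \<nu>s \<phi> x\<bar> \<le> \<epsilon> / 2"
    by (auto simp: mean)
  obtain m0 :: nat where m0: "real N * B \<le> real m0 * (\<epsilon> / 2)"
    using reals_Archimedean3[of "\<epsilon> / 2"] \<epsilon> by (meson half_gt_zero less_imp_le)
  \<comment> \<open>The successor makes \<open>m\<close> positive, so that blocks of length \<open>m\<close> shorten a list.\<close>
  define m where "m = Suc m0"
  have m: "real N * B \<le> real m * (\<epsilon> / 2)"
    using m0 \<epsilon> by (simp add: m_def algebra_simps)
  have "expected_sum \<phi> \<nu>s x \<le> \<epsilon> * real m" if \<nu>s: "set \<nu>s \<subseteq> K" "length \<nu>s = m" for \<nu>s x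
  proof -
    have t: "set (take k \<nu>s) \<subseteq> K" for k using \<nu>s(1) set_take_subset[of k \<nu>s] by blast
    have "foldr convolve (take k \<nu>s) \<phi> x \<le> (if k < N then B else 0) + \<epsilon> / 2" if "k < m" for k
    proof (cases "k < N")
      case True
      have "\<bar>foldr convolve (take k \<nu>s) \<phi> x\<bar> \<le> B"
        using t KB by (intro foldr_convolve_bounded \<phi> B(2)) blast
      then show ?thesis using True \<epsilon> by simp
    next
      case False
      then have "\<bar>foldr convolve (take k \<nu>s) \<phi> x\<bar> \<le> \<epsilon> / 2"
        using that \<nu>s(2) by (intro N t) auto
      then show ?thesis using False by simp
    qed
    then have "expected_sum \<phi> \<nu>s x \<le> (\<Sum>k<m. (if k < N then B else 0) + \<epsilon> / 2)"
      unfolding expected_sum_def \<nu>s(2) by (intro sum_mono) auto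
    also have "\<dots> = (\<Sum>k\<in>{..<m} \<inter> {..<N}. B) + real m * (\<epsilon> / 2)"
      by (simp only: sum.distrib sum.inter_restrict[OF finite_lessThan] lessThan_iff) simp
    also have "(\<Sum>k\<in>{..<m} \<inter> {..<N}. B) \<le> real N * B"
      using B(1) card_mono[of "{..<N}" "{..<m} \<inter> {..<N}"] by simp
    finally show ?thesis using m by (simp add: mult.commute)
  qed
  then show thesis using that[of m] by (simp add: m_def)
qed

text \<open>
  For a block length \<open>m\<close> with small expected sum, a sufficiently small \<open>s\<close> makes the first-order term
  dominate, so every block multiplies the exponential moment by at most \<open>exp (s * \<epsilon> * m)\<close>. Cutting a
  long walk into blocks leaves a remainder of fewer than \<open>m\<close> steps, whose contribution is the
  constant \<open>C\<close>.
\<close>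
lemma exp_moment_growth:
  fixes h :: "'a::compact_metric_ab_group measure"
  assumes h: "is_haar h" and K: "compactin weak_star K" and ap: "\<forall>\<nu>\<in>K. strictly_aperiodic \<nu>"
    and \<phi>: "continuous_on UNIV \<phi>" and mean: "(\<integral>y. \<phi> y \<partial>h) = 0" and \<epsilon>: "\<epsilon> > 0"
  obtains s C where "s > 0" "C > 0"
    "\<forall>\<nu>s x. set \<nu>s \<subseteq> K \<longrightarrow> exp_moment s \<phi> \<nu>s x \<le> C * exp (s * \<epsilon> * real (length \<nu>s))"
proof -
  have KB: "K \<subseteq> borel_prob_measures"
    using compactin_subset_topspace[OF K] by simp
  obtain B where B: "B > 0" "\<And>x. \<bar>\<phi> x\<bar> \<le> B" using continuous_bounded[OF \<phi>] by blast
  have "\<epsilon> / 2 > 0" using \<epsilon> by simp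
  then obtain m where m: "m \<ge> 1"
    "\<forall>\<nu>s x. set \<nu>s \<subseteq> K \<longrightarrow> length \<nu>s = m \<longrightarrow> expected_sum \<phi> \<nu>s x \<le> \<epsilon> / 2 * real m"
    by (rule expected_sum_small[OF h K ap \<phi> mean])
  obtain D where D: "D \<ge> 0"
    "\<And>s \<nu>s x. s \<ge> 0 \<Longrightarrow> s * B \<le> 1 \<Longrightarrow> set \<nu>s \<subseteq> borel_prob_measures \<Longrightarrow> length \<nu>s = m \<Longrightarrow>
      exp_moment s \<phi> \<nu>s x \<le> 1 + s * expected_sum \<phi> \<nu>s x + D * s\<^sup>2"
    using exp_moment_le_second_order[of \<phi> B m, OF \<phi> B(2)] by blast
  \<comment> \<open>The first bound lets the second-order estimate apply, the second makes its error at most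
    \<open>s * \<epsilon> * m / 2\<close>; adding one to \<open>D\<close> excludes division by zero.\<close>
  define s where "s = min (1 / B) (real m * \<epsilon> / (2 * (D + 1)))"
  have s: "s > 0" using B(1) m(1) \<epsilon> D(1) by (simp add: s_def)
  have "s * B \<le> 1 / B * B" using B(1) by (intro mult_right_mono) (auto simp: s_def)
  then have sB: "s * B \<le> 1" using B(1) by simp
  have "s * D \<le> real m * \<epsilon> / (2 * (D + 1)) * (D + 1)"
    using D(1) s \<epsilon> by (intro mult_mono) (auto simp: s_def)
  also have "\<dots> = real m * \<epsilon> / 2" using D(1) by (simp add: field_simps)
  finally have "s * (s * D) \<le> s * (real m * \<epsilon> / 2)" using s by (intro mult_left_mono) auto
  then have sD: "D * s\<^sup>2 \<le> s * \<epsilon> * real m / 2"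
    by (simp add: power2_eq_square mult_ac)
  have block: "exp_moment s \<phi> \<nu>s x \<le> exp (s * \<epsilon> * real m)"
    if "set \<nu>s \<subseteq> K" "length \<nu>s = m" for \<nu>s x
  proof -
    have "exp_moment s \<phi> \<nu>s x \<le> 1 + s * expected_sum \<phi> \<nu>s x + D * s\<^sup>2"
      using that KB s by (intro D(2) sB) auto
    also have "s * expected_sum \<phi> \<nu>s x \<le> s * (\<epsilon> / 2 * real m)"
      using m(2) that s by (intro mult_left_mono) auto
    finally have "exp_moment s \<phi> \<nu>s x \<le> 1 + s * \<epsilon> * real m" using sD by simp
    then show ?thesis using exp_ge_add_one_self[of "s * \<epsilon> * real m"] by linarith
  qed
  define C where "C = exp (s * B * real m)"
  have "\<forall>x. exp_moment s \<phi> \<nu>s x \<le> C * exp (s * \<epsilon> * real (length \<nu>s))" if "set \<nu>s \<subseteq> K" for \<nu>s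
    using that
  proof (induction \<nu>s rule: length_induct)
    case (1 \<nu>s)
    show ?case
    proof (cases "length \<nu>s < m")
      case True
      have "exp_moment s \<phi> \<nu>s x \<le> exp (s * B * real (length \<nu>s))" for x
        using 1(2) KB s by (intro exp_moment_le_exp \<phi> B(2)) auto
      also have "exp (s * B * real (length \<nu>s)) \<le> C"
        using True s B(1) by (simp add: C_def)
      also have "C \<le> C * exp (s * \<epsilon> * real (length \<nu>s))"
        using s \<epsilon> by (simp add: C_def)
      finally show ?thesis by blast
    next
      case False
      define c where "c = C * exp (s * \<epsilon> * real (length (drop m \<nu>s)))"
      have sub: "set (drop m \<nu>s) \<subseteq> K" "set (take m \<nu>s) \<subseteq> K"
        using 1(2) set_drop_subset[of m \<nu>s] set_take_subset[of m \<nu>s] by blast+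
      have "exp_moment s \<phi> (drop m \<nu>s) y \<le> c" for y
      proof -
        have "length (drop m \<nu>s) < length \<nu>s" using False m(1) by simp
        then show ?thesis using 1(1) sub(1) unfolding c_def by blast
      qed
      then have "exp_moment s \<phi> (take m \<nu>s @ drop m \<nu>s) x \<le> c * exp_moment s \<phi> (take m \<nu>s) x" for x
        using sub KB by (intro exp_moment_append_le \<phi>) auto
      moreover have "c * exp_moment s \<phi> (take m \<nu>s) x \<le> c * exp (s * \<epsilon> * real m)" for x
        using sub False by (intro mult_left_mono block) (auto simp: c_def C_def)
      moreover have "c * exp (s * \<epsilon> * real m) = C * exp (s * \<epsilon> * real (length \<nu>s))"
        using False by (simp add: c_def exp_add [symmetric] of_nat_diff algebra_simps)
      ultimately show ?thesis by (metis append_take_drop_id order_trans)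
    qed
  qed
  then show thesis using that[OF s, of C] by (simp add: C_def)
qed

section \<open>The random walk\<close>

text \<open>
  The walk that starts at time \<open>i\<close>, with steps \<open>\<alpha>(i + 1)\<close>, \<open>\<alpha>(i + 2)\<close>, \<open>\<dots>\<close>. The parameter \<open>i\<close> makes the
  family closed under removing the first step.
\<close>
definition ergodic_sum ::
  "('a::compact_metric_ab_group \<Rightarrow> real) \<Rightarrow> nat \<Rightarrow> nat \<Rightarrow> 'a \<Rightarrow> (nat \<Rightarrow> 'a) \<Rightarrow> real" where
  "ergodic_sum \<phi> i n x \<alpha> = (\<Sum>k<n. \<phi> (x + (\<Sum>j=Suc i..i + k. \<alpha> j)))"

lemma ergodic_sum_measurable:
  fixes \<mu> :: "nat \<Rightarrow> 'a::compact_metric_ab_group measure"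
  assumes \<mu>: "\<And>j. j > i \<Longrightarrow> \<mu> j \<in> borel_prob_measures" and \<phi>: "continuous_on UNIV \<phi>"
  shows "ergodic_sum \<phi> i n x \<in> borel_measurable (\<Pi>\<^sub>M j\<in>{Suc i..}. \<mu> j)"
proof -
  have [measurable]: "\<phi> \<in> borel_measurable borel"
    by (rule borel_measurable_continuous_onI[OF \<phi>])
  have c: "(\<lambda>\<alpha>. \<alpha> j) \<in> borel_measurable (\<Pi>\<^sub>M j\<in>{Suc i..}. \<mu> j)" if "j > i" for j
  proof -
    have "(\<lambda>\<alpha>. \<alpha> j) \<in> measurable (\<Pi>\<^sub>M j\<in>{Suc i..}. \<mu> j) (\<mu> j)"
      by (rule measurable_component_singleton) (use that in auto)
    then show ?thesis
      by (subst (asm) measurable_cong_sets[OF refl borel_prob_measuresD(2)[OF \<mu>[OF that]]])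
  qed
  have [measurable]: "(\<lambda>\<alpha>. \<Sum>j=Suc i..i + k. \<alpha> j) \<in> borel_measurable (\<Pi>\<^sub>M j\<in>{Suc i..}. \<mu> j)" for k
    by (intro borel_measurable_sum c) auto
  show ?thesis unfolding ergodic_sum_def by measurable
qed

lemma ergodic_sum_Suc:
  "ergodic_sum \<phi> i (Suc n) x (\<alpha>(Suc i := a)) = \<phi> x + ergodic_sum \<phi> (Suc i) n (x + a) \<alpha>"
proof -
  have "(\<Sum>j=Suc i..i + Suc k. (\<alpha>(Suc i := a)) j) = a + (\<Sum>j=Suc (Suc i)..Suc i + k. \<alpha> j)" for k
    by (subst sum.atLeast_Suc_atMost) (auto intro!: sum.cong)
  then show ?thesis
    unfolding ergodic_sum_def
    by (subst sum.lessThan_Suc_shift) (simp add: add.assoc)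
qed

text \<open>
  The product of the laws from \<open>i + 1\<close> on is the product of the law of the first step and the
  product of the remaining ones, so Fubini reproduces the recursion for \<open>exp_moment\<close>. Nonnegative
  integrals are used so that Fubini needs no integrability on the product space.
\<close>
lemma expectation_exp_ergodic_sum:
  fixes \<mu> :: "nat \<Rightarrow> 'a::compact_metric_ab_group measure"
  assumes \<mu>: "\<And>j. j > i \<Longrightarrow> \<mu> j \<in> borel_prob_measures" and \<phi>: "continuous_on UNIV \<phi>"
  shows "(\<integral>\<^sup>+\<alpha>. ennreal (exp (s * ergodic_sum \<phi> i n x \<alpha>)) \<partial>(\<Pi>\<^sub>M j\<in>{Suc i..}. \<mu> j))
    = ennreal (exp_moment s \<phi> (map \<mu> [Suc i..<Suc i + n]) x)"
  using \<mu>
proof (induction n arbitrary: i x)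
  case 0
  interpret prob_space "\<Pi>\<^sub>M j\<in>{Suc i..}. \<mu> j"
    by (rule prob_space_PiM) (use 0 in \<open>auto intro: borel_prob_measuresD\<close>)
  show ?case by (simp add: ergodic_sum_def emeasure_space_1)
next
  case (Suc n)
  let ?P = "\<Pi>\<^sub>M j\<in>{Suc (Suc i)..}. \<mu> j" and ?Q = "\<Pi>\<^sub>M j\<in>{Suc i..}. \<mu> j"
  let ?\<nu> = "\<mu> (Suc i)" and ?\<nu>s = "map \<mu> [Suc (Suc i)..<Suc (Suc i) + n]"
  have ins: "insert (Suc i) {Suc (Suc i)..} = {Suc i..}" by auto
  have \<nu>: "?\<nu> \<in> borel_prob_measures" "set ?\<nu>s \<subseteq> borel_prob_measures" using Suc.prems by auto
  interpret \<nu>: prob_space ?\<nu> by (rule borel_prob_measuresD(1)[OF \<nu>(1)])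
  interpret P: prob_space ?P
    by (rule prob_space_PiM) (use Suc.prems in \<open>auto intro: borel_prob_measuresD\<close>)
  have Q: "?Q = distr (?\<nu> \<Otimes>\<^sub>M ?P) ?Q (\<lambda>(a, \<alpha>). \<alpha>(Suc i := a))"
    using distr_pair_PiM_eq_PiM[of "{Suc (Suc i)..}" \<mu> "Suc i", OF _ \<nu>.prob_space_axioms]
      borel_prob_measuresD(1)[OF Suc.prems] by (simp add: ins)
  have upd: "(\<lambda>(a, \<alpha>). \<alpha>(Suc i := a)) \<in> measurable (?\<nu> \<Otimes>\<^sub>M ?P) ?Q"
    using measurable_fun_upd[of "{Suc i..}" "{Suc (Suc i)..}" "Suc i" snd "?\<nu> \<Otimes>\<^sub>M ?P" \<mu> fst]
    by (simp add: ins[symmetric] case_prod_beta' insert_commute)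
  have m: "(\<lambda>\<alpha>. ennreal (exp (s * ergodic_sum \<phi> i (Suc n) x \<alpha>))) \<in> borel_measurable ?Q"
    using ergodic_sum_measurable[of i \<mu> \<phi> "Suc n" x, OF Suc.prems \<phi>] by measurable
  note m' = measurable_compose[OF upd m]
  have "(\<integral>\<^sup>+\<alpha>. ennreal (exp (s * ergodic_sum \<phi> i (Suc n) x \<alpha>)) \<partial>?Q)
      = (\<integral>\<^sup>+(a, \<alpha>). ennreal (exp (s * ergodic_sum \<phi> i (Suc n) x (\<alpha>(Suc i := a)))) \<partial>(?\<nu> \<Otimes>\<^sub>M ?P))"
    by (subst Q, subst nn_integral_distr[OF upd])
      (use m in \<open>simp_all only: measurable_distr_eq1 case_prod_beta'\<close>)
  also have "\<dots> = (\<integral>\<^sup>+a. \<integral>\<^sup>+\<alpha>. ennreal (exp (s * ergodic_sum \<phi> i (Suc n) x (\<alpha>(Suc i := a)))) \<partial>?P \<partial>?\<nu>)"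
    using m' by (subst P.nn_integral_fst[symmetric]) (auto simp: case_prod_beta')
  also have "\<dots> = (\<integral>\<^sup>+a. ennreal (exp (s * \<phi> x)) *
      (\<integral>\<^sup>+\<alpha>. ennreal (exp (s * ergodic_sum \<phi> (Suc i) n (x + a) \<alpha>)) \<partial>?P) \<partial>?\<nu>)"
  proof (rule nn_integral_cong)
    fix a
    have [measurable]: "ergodic_sum \<phi> (Suc i) n (x + a) \<in> borel_measurable ?P"
      by (rule ergodic_sum_measurable[OF Suc.prems \<phi>]) simp
    show "(\<integral>\<^sup>+\<alpha>. ennreal (exp (s * ergodic_sum \<phi> i (Suc n) x (\<alpha>(Suc i := a)))) \<partial>?P)
      = ennreal (exp (s * \<phi> x)) *
        (\<integral>\<^sup>+\<alpha>. ennreal (exp (s * ergodic_sum \<phi> (Suc i) n (x + a) \<alpha>)) \<partial>?P)"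
      by (simp add: ergodic_sum_Suc distrib_left exp_add ennreal_mult nn_integral_cmult)
  qed
  also have "\<dots> = (\<integral>\<^sup>+a. ennreal (exp (s * \<phi> x)) * ennreal (exp_moment s \<phi> ?\<nu>s (x + a)) \<partial>?\<nu>)"
    using Suc.IH[of "Suc i"] Suc.prems by simp
  also have "\<dots> = (\<integral>\<^sup>+a. ennreal (exp (s * \<phi> x) * exp_moment s \<phi> ?\<nu>s (x + a)) \<partial>?\<nu>)"
    by (simp add: ennreal_mult exp_moment_nonneg)
  also have "\<dots> = ennreal (\<integral>a. exp (s * \<phi> x) * exp_moment s \<phi> ?\<nu>s (x + a) \<partial>?\<nu>)"
    using integrable_translate[OF \<nu>(1) exp_moment_continuous[OF \<nu>(2) \<phi>]]
    by (intro nn_integral_eq_integral AE_I2 mult_nonneg_nonneg exp_ge_zero exp_moment_nonneg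
        integrable_mult_right)
  also have "\<dots> = ennreal (exp_moment s \<phi> (?\<nu> # ?\<nu>s) x)"
    by (simp add: convolve_def)
  also have "?\<nu> # ?\<nu>s = map \<mu> [Suc i..<Suc i + Suc n]"
    by (simp add: upt_conv_Cons del: upt_Suc)
  finally show ?case .
qed

section \<open>Large deviations and almost sure convergence\<close>

text \<open>
  Chernoff bound: the moment grows at most like \<open>exp (s * \<epsilon> / 2 * n)\<close>, half the rate needed to
  compensate the factor \<open>exp (- s * \<epsilon> * n)\<close>.
\<close>
lemma ergodic_sum_tail:
  fixes h :: "'a::compact_metric_ab_group measure" and \<mu> :: "nat \<Rightarrow> 'a measure"
  assumes h: "is_haar h" and K: "compactin weak_star K" and ap: "\<forall>\<nu>\<in>K. strictly_aperiodic \<nu>"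
    and \<mu>: "\<forall>n\<ge>1. \<mu> n \<in> K"
    and \<phi>: "continuous_on UNIV \<phi>" and mean: "(\<integral>y. \<phi> y \<partial>h) = 0" and \<epsilon>: "\<epsilon> > 0"
  obtains C \<delta> where "C > 0" "\<delta> > 0"
    "\<forall>x n. measure (\<Pi>\<^sub>M j\<in>{Suc 0..}. \<mu> j)
      {\<alpha> \<in> space (\<Pi>\<^sub>M j\<in>{Suc 0..}. \<mu> j). ergodic_sum \<phi> 0 n x \<alpha> \<ge> \<epsilon> * real n} \<le> C * exp (- \<delta> * real n)"
proof -
  let ?P = "\<Pi>\<^sub>M j\<in>{Suc 0..}. \<mu> j"
  have \<mu>B: "\<mu> j \<in> borel_prob_measures" if "j > 0" for j
    using that \<mu> compactin_subset_topspace[OF K] by auto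
  interpret prob_space ?P
    by (rule prob_space_PiM) (use \<mu>B in \<open>auto intro: borel_prob_measuresD\<close>)
  have "\<epsilon> / 2 > 0" using \<epsilon> by simp
  then obtain s C where s: "s > 0" "C > 0"
    "\<forall>\<nu>s x. set \<nu>s \<subseteq> K \<longrightarrow> exp_moment s \<phi> \<nu>s x \<le> C * exp (s * (\<epsilon> / 2) * real (length \<nu>s))"
    by (rule exp_moment_growth[OF h K ap \<phi> mean])
  have "prob {\<alpha> \<in> space ?P. ergodic_sum \<phi> 0 n x \<alpha> \<ge> \<epsilon> * real n} \<le> C * exp (- (s * \<epsilon> / 2) * real n)"
    for x n
  proof -
    let ?\<nu>s = "map \<mu> [Suc 0..<Suc 0 + n]"
    have [measurable]: "ergodic_sum \<phi> 0 n x \<in> borel_measurable ?P"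
      using ergodic_sum_measurable[of 0 \<mu> \<phi> n x, OF \<mu>B \<phi>] by simp
    have "set ?\<nu>s \<subseteq> K" using \<mu> by auto
    then have g: "exp_moment s \<phi> ?\<nu>s x \<le> C * exp (s * (\<epsilon> / 2) * real n)"
      using s(3) by (metis length_map length_upt diff_add_inverse)
    have "emeasure ?P {\<alpha> \<in> space ?P. ergodic_sum \<phi> 0 n x \<alpha> \<ge> \<epsilon> * real n}
        \<le> ennreal (exp (- s * (\<epsilon> * real n))) *
          (\<integral>\<^sup>+\<alpha>. ennreal (exp (s * ergodic_sum \<phi> 0 n x \<alpha>)) * indicator (space ?P) \<alpha> \<partial>?P)"
      by (intro Chernoff_ineq_nn_integral_ge s(1)) auto
    also have "(\<integral>\<^sup>+\<alpha>. ennreal (exp (s * ergodic_sum \<phi> 0 n x \<alpha>)) * indicator (space ?P) \<alpha> \<partial>?P)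
        = (\<integral>\<^sup>+\<alpha>. ennreal (exp (s * ergodic_sum \<phi> 0 n x \<alpha>)) \<partial>?P)"
      by (intro nn_integral_cong) simp
    also have "\<dots> = ennreal (exp_moment s \<phi> ?\<nu>s x)"
      using expectation_exp_ergodic_sum[of 0 \<mu> \<phi> s n x, OF \<mu>B \<phi>] by simp
    also have "ennreal (exp (- s * (\<epsilon> * real n))) * \<dots>
        \<le> ennreal (exp (- s * (\<epsilon> * real n))) * ennreal (C * exp (s * (\<epsilon> / 2) * real n))"
      using g by (intro mult_left_mono ennreal_leI) auto
    also have "\<dots> = ennreal (C * exp (- (s * \<epsilon> / 2) * real n))"
      using s(2) by (simp add: ennreal_mult[symmetric] exp_add[symmetric] field_simps)
    finally show ?thesis
      using s(2) by (simp add: emeasure_eq_measure)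
  qed
  then show thesis using that[of C "s * \<epsilon> / 2"] s(1,2) \<epsilon> by auto
qed

lemma ergodic_sum_diff_const:
  "ergodic_sum (\<lambda>y. \<phi> y - c) i n x \<alpha> = ergodic_sum \<phi> i n x \<alpha> - real n * c"
  by (simp add: ergodic_sum_def sum_subtractf)

lemma ergodic_sum_const_diff:
  "ergodic_sum (\<lambda>y. c - \<phi> y) i n x \<alpha> = real n * c - ergodic_sum \<phi> i n x \<alpha>"
  by (simp add: ergodic_sum_def sum_subtractf)

text \<open>
  A deviation from the mean \<open>c\<close> is a large ergodic sum of \<open>\<phi> - c\<close> or of \<open>c - \<phi>\<close>, two functions of
  mean zero.
\<close>
lemma ergodic_average_large_deviation:
  fixes h :: "'a::compact_metric_ab_group measure" and \<mu> :: "nat \<Rightarrow> 'a measure"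
  assumes h: "is_haar h" and K: "compactin weak_star K" and ap: "\<forall>\<nu>\<in>K. strictly_aperiodic \<nu>"
    and \<mu>: "\<forall>n\<ge>1. \<mu> n \<in> K"
    and \<phi>: "continuous_on UNIV \<phi>" and \<epsilon>: "\<epsilon> > 0"
  shows "\<exists>C>0. \<exists>\<delta>>0. \<forall>x. \<forall>n\<ge>1.
    measure (\<Pi>\<^sub>M n\<in>{Suc 0..}. \<mu> n)
      {\<alpha> \<in> space (\<Pi>\<^sub>M n\<in>{Suc 0..}. \<mu> n).
         \<bar>1 / real n * ergodic_sum \<phi> 0 n x \<alpha> - (\<integral>y. \<phi> y \<partial>h)\<bar> > \<epsilon>} < C * exp (- \<delta> * real n)"
proof -
  let ?P = "\<Pi>\<^sub>M j\<in>{Suc 0..}. \<mu> j"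
  define c where "c = (\<integral>y. \<phi> y \<partial>h)"
  have \<mu>B: "\<mu> j \<in> borel_prob_measures" if "j > 0" for j
    using that \<mu> compactin_subset_topspace[OF K] by auto
  interpret prob_space ?P
    by (rule prob_space_PiM) (use \<mu>B in \<open>auto intro: borel_prob_measuresD\<close>)
  interpret h: prob_space h by (rule borel_prob_measuresD(1)[OF is_haarD(1)[OF h]])
  have i: "integrable h \<phi>" by (rule integrable_continuous[OF is_haarD(1)[OF h] \<phi>])
  have mean: "(\<integral>y. \<phi> y - c \<partial>h) = 0" "(\<integral>y. c - \<phi> y \<partial>h) = 0"
    using i h.prob_space by (simp_all add: c_def)
  have cont: "continuous_on UNIV (\<lambda>y. \<phi> y - c)" "continuous_on UNIV (\<lambda>y. c - \<phi> y)"
    by (intro continuous_intros \<phi>)+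
  define U where "U n x = {\<alpha> \<in> space ?P. ergodic_sum (\<lambda>y. \<phi> y - c) 0 n x \<alpha> \<ge> \<epsilon> * real n}" for n x
  define V where "V n x = {\<alpha> \<in> space ?P. ergodic_sum (\<lambda>y. c - \<phi> y) 0 n x \<alpha> \<ge> \<epsilon> * real n}" for n x
  obtain C1 \<delta>1 where 1: "C1 > 0" "\<delta>1 > 0" "\<forall>x n. prob (U n x) \<le> C1 * exp (- \<delta>1 * real n)"
    unfolding U_def by (rule ergodic_sum_tail[OF h K ap \<mu> cont(1) mean(1) \<epsilon>])
  obtain C2 \<delta>2 where 2: "C2 > 0" "\<delta>2 > 0" "\<forall>x n. prob (V n x) \<le> C2 * exp (- \<delta>2 * real n)"
    unfolding V_def by (rule ergodic_sum_tail[OF h K ap \<mu> cont(2) mean(2) \<epsilon>])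
  define \<delta> where "\<delta> = min \<delta>1 \<delta>2"
  have "prob {\<alpha> \<in> space ?P. \<bar>1 / real n * ergodic_sum \<phi> 0 n x \<alpha> - c\<bar> > \<epsilon>}
      < (C1 + C2 + 1) * exp (- \<delta> * real n)" if n: "n \<ge> 1" for n x
  proof -
    have [measurable]: "ergodic_sum (\<lambda>y. \<phi> y - c) 0 n x \<in> borel_measurable ?P"
        "ergodic_sum (\<lambda>y. c - \<phi> y) 0 n x \<in> borel_measurable ?P"
      using ergodic_sum_measurable[of 0 \<mu> _ n x, OF \<mu>B] cont by simp_all
    have ev: "U n x \<in> events" "V n x \<in> events" unfolding U_def V_def by measurable
    have "\<alpha> \<in> U n x \<union> V n x"
      if \<alpha>: "\<alpha> \<in> space ?P" "\<bar>1 / real n * ergodic_sum \<phi> 0 n x \<alpha> - c\<bar> > \<epsilon>" for \<alpha>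
    proof -
      have "real n * \<epsilon> \<le> real n * \<bar>1 / real n * ergodic_sum \<phi> 0 n x \<alpha> - c\<bar>"
        using \<alpha>(2) by (intro mult_left_mono) auto
      also have "\<dots> = \<bar>real n * (1 / real n * ergodic_sum \<phi> 0 n x \<alpha> - c)\<bar>"
        by (simp add: abs_mult)
      also have "real n * (1 / real n * ergodic_sum \<phi> 0 n x \<alpha> - c)
          = ergodic_sum \<phi> 0 n x \<alpha> - real n * c"
        using n by (simp add: right_diff_distrib)
      finally have "\<epsilon> * real n \<le> \<bar>ergodic_sum \<phi> 0 n x \<alpha> - real n * c\<bar>"
        by (simp add: mult.commute)
      then show ?thesis
        using \<alpha>(1) by (auto simp: U_def V_def ergodic_sum_diff_const ergodic_sum_const_diff abs_if
            split: if_splits)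
    qed
    then have "prob {\<alpha> \<in> space ?P. \<bar>1 / real n * ergodic_sum \<phi> 0 n x \<alpha> - c\<bar> > \<epsilon>}
        \<le> prob (U n x \<union> V n x)"
      using ev by (intro finite_measure_mono) auto
    also have "\<dots> \<le> prob (U n x) + prob (V n x)"
      by (rule measure_Un_le[OF ev])
    also have "\<dots> \<le> C1 * exp (- \<delta>1 * real n) + C2 * exp (- \<delta>2 * real n)"
      using 1(3) 2(3) by (intro add_mono) auto
    also have "\<dots> \<le> C1 * exp (- \<delta> * real n) + C2 * exp (- \<delta> * real n)"
      using 1(1) 2(1) by (intro add_mono mult_left_mono) (auto simp: \<delta>_def mult_right_mono)
    also have "\<dots> < (C1 + C2 + 1) * exp (- \<delta> * real n)"
      by (simp add: algebra_simps)
    finally show ?thesis .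
  qed
  then show ?thesis
    using 1(1,2) 2(1,2) unfolding c_def[symmetric]
    by (intro exI[of _ "C1 + C2 + 1"] conjI exI[of _ \<delta>]) (auto simp: \<delta>_def)
qed

text \<open>
  The probabilities of \<open>1 / (m + 1)\<close>-deviations are summable over \<open>n\<close>, so Borel--Cantelli applies for
  each of the countably many \<open>m\<close>.
\<close>
lemma ergodic_average_AE_tendsto:
  fixes h :: "'a::compact_metric_ab_group measure" and \<mu> :: "nat \<Rightarrow> 'a measure"
  assumes h: "is_haar h" and K: "compactin weak_star K" and ap: "\<forall>\<nu>\<in>K. strictly_aperiodic \<nu>"
    and \<mu>: "\<forall>n\<ge>1. \<mu> n \<in> K" and \<phi>: "continuous_on UNIV \<phi>"
  shows "AE \<alpha> in (\<Pi>\<^sub>M n\<in>{Suc 0..}. \<mu> n).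
    (\<lambda>n. 1 / real n * ergodic_sum \<phi> 0 n x \<alpha>) \<longlonglongrightarrow> (\<integral>y. \<phi> y \<partial>h)"
proof -
  let ?P = "\<Pi>\<^sub>M j\<in>{Suc 0..}. \<mu> j"
  define c where "c = (\<integral>y. \<phi> y \<partial>h)"
  define A where "A n \<alpha> = 1 / real n * ergodic_sum \<phi> 0 n x \<alpha>" for n \<alpha>
  have \<mu>B: "\<mu> j \<in> borel_prob_measures" if "j > 0" for j
    using that \<mu> compactin_subset_topspace[OF K] by auto
  interpret prob_space ?P
    by (rule prob_space_PiM) (use \<mu>B in \<open>auto intro: borel_prob_measuresD\<close>)
  have [measurable]: "A n \<in> borel_measurable ?P" for n
    unfolding A_def using ergodic_sum_measurable[of 0 \<mu> \<phi> n x, OF \<mu>B \<phi>] by simp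
  have ae: "AE \<alpha> in ?P. \<forall>\<^sub>F n in sequentially. \<bar>A n \<alpha> - c\<bar> \<le> \<epsilon>" if \<epsilon>: "\<epsilon> > 0" for \<epsilon>
  proof -
    define D where "D n = {\<alpha> \<in> space ?P. \<bar>A n \<alpha> - c\<bar> > \<epsilon>}" for n
    have D: "D n \<in> events" for n unfolding D_def by measurable
    obtain C \<delta> where C: "\<delta> > 0" "\<And>n. n \<ge> 1 \<Longrightarrow> prob (D n) < C * exp (- \<delta> * real n)"
      using ergodic_average_large_deviation[OF h K ap \<mu> \<phi> \<epsilon>] unfolding D_def A_def c_def by blast
    have "summable (\<lambda>n. C * exp (- \<delta>) ^ n)"
      using C(1) by (intro summable_mult summable_geometric) simp
    then have "summable (\<lambda>n. prob (D n))"
    proof (rule summable_comparison_test'[where N = 1])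
      fix n :: nat assume "n \<ge> 1"
      then show "norm (prob (D n)) \<le> C * exp (- \<delta>) ^ n"
        using C(2)[of n] by (simp add: exp_of_nat_mult[symmetric] mult.commute)
    qed
    then have "AE \<alpha> in ?P. \<forall>\<^sub>F n in sequentially. \<alpha> \<in> space ?P - D n"
      using D by (intro borel_cantelli_AE1) (auto simp: emeasure_eq_measure)
    then show ?thesis
      by eventually_elim (auto simp: D_def not_less elim: eventually_mono)
  qed
  have "AE \<alpha> in ?P. \<forall>m. \<forall>\<^sub>F n in sequentially. \<bar>A n \<alpha> - c\<bar> \<le> 1 / real (Suc m)"
    unfolding AE_all_countable by (intro allI ae) simp
  then have "AE \<alpha> in ?P. (\<lambda>n. A n \<alpha>) \<longlonglongrightarrow> c"
  proof eventually_elim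
    case (elim \<alpha>)
    show ?case
    proof (rule tendstoI)
      fix e :: real assume "e > 0"
      then obtain m where m: "1 / real (Suc m) < e" using nat_approx_posE by blast
      from elim have "\<forall>\<^sub>F n in sequentially. \<bar>A n \<alpha> - c\<bar> \<le> 1 / real (Suc m)" by blast
      then show "\<forall>\<^sub>F n in sequentially. dist (A n \<alpha>) c < e"
        by eventually_elim (use m in \<open>simp add: dist_real_def\<close>)
    qed
  qed
  then show ?thesis by (simp add: A_def c_def)
qed

theorem theorem1p2:
  fixes h :: "'a::compact_metric_ab_group measure"
    and K :: "'a measure set"
    and \<mu> :: "nat \<Rightarrow> 'a measure"
  assumes "is_haar h"
    and "compactin weak_star K"
    and "\<forall>\<nu>\<in>K. strictly_aperiodic \<nu>"
    and "\<forall>n\<ge>1. \<mu> n \<in> K"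
  shows
    "(\<forall>\<phi> :: 'a \<Rightarrow> real. continuous_on UNIV \<phi> \<longrightarrow>
        (\<forall>x. AE \<alpha> in (\<Pi>\<^sub>M n\<in>{1..}. \<mu> n).
          (\<lambda>n. 1 / real n * (\<Sum>k<n. \<phi> (x + (\<Sum>j=1..k. \<alpha> j)))) \<longlonglongrightarrow> (\<integral>y. \<phi> y \<partial>h))) \<and>
     (\<forall>\<phi> :: 'a \<Rightarrow> real. continuous_on UNIV \<phi> \<longrightarrow>
        (\<forall>\<epsilon>>0. \<exists>C>0. \<exists>\<delta>>0. \<forall>x. \<forall>n\<ge>1.
          measure (\<Pi>\<^sub>M n\<in>{1..}. \<mu> n)
            {\<alpha> \<in> space (\<Pi>\<^sub>M n\<in>{1..}. \<mu> n).
               \<bar>1 / real n * (\<Sum>k<n. \<phi> (x + (\<Sum>j=1..k. \<alpha> j))) - (\<integral>y. \<phi> y \<partial>h)\<bar> > \<epsilon>}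
          < C * exp (- \<delta> * real n)))"
proof -
  have sum: "(\<Sum>k<n. \<phi> (x + (\<Sum>j=1..k. \<alpha> j))) = ergodic_sum \<phi> 0 n x \<alpha>" for \<phi> n x and \<alpha> :: "nat \<Rightarrow> 'a"
    by (simp add: ergodic_sum_def)
  show ?thesis
    unfolding sum unfolding One_nat_def
    using ergodic_average_AE_tendsto[OF assms] ergodic_average_large_deviation[OF assms, unfolded One_nat_def] by blast
qed

end
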